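(* The map $q:\widehat{\mathbb{H}}\to\mathbb{H}$ is a local homeomorphism.
   Context: **Hawaiian Earring.** $\mathbb{H}=\bigcup_{i\in\mathbb N}C_i\subseteq\mathbb R^2$ with $C_i=\{(x,y)\in\mathbb{R}^2: x^2+(y-1/i)^2=1/i^2\}$, $i=1,2,3,\dots$, with the subspace topology and base point $\mathbf 0=(0,0)$. Let $l_i:[0,1]\to C_i$, $l_i(t)=((\sin 2\pi t)/i,(1-\cos 2\pi t)/i)$. **Words and Cayley tree.** Let $\mathcal W_n$ be the set of finite words over $\{a_1^{\pm1},\dots,a_n^{\pm1}\}$ and $\mathcal W=\bigcup_n\mathcal W_n$. For $w\in\mathcal W$, $w'$ is its complete free reduction and $|w|$ its length; $\mathbf 1$ denotes the empty word. Let $\Gamma$ be the directed Cayley graph of the free group on $\{a_1,a_2,\dots\}$: the vertex set $V$ is the set of reduced words, and there is a directed edge labeled $a_i$ from $u$ to $(ua_i)'$ for every $u\in V$, $i\in\mathbb N$. The underlying undirected graph is a tree. Fix a complete list $w_1,w_2,w_3,\dots$ of all non-empty words in $\mathcal W$. For each $j$ let $\widehat w_j=a_1a_2a_1a_2\cdots\in V$ be the word with letters alternating between $a_1$ and $a_2$ (starting with $a_1$) of length $|\widehat w_j|=2(|w_1|+\cdots+|w_{j-1}|)+3j+|w_j|$. **The graph $\widehat{\mathbb H}$.** Step 1: If $w_j=x_1x_2\cdots x_m$ with letters $x_i$, let $Z_j=\{(\widehat w_jx_1\cdots x_i)': 0\le i\le m\}$. Let $Z$ be the set of vertices of the infinite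 ray in $\Gamma$ starting at $\mathbf 1$ and following the edges $a_1,a_2,a_1,a_2,\dots$. Step 2: Let $n=n(j)\ge2$ be minimal with $w_j\in\mathcal W_n$. For $u\in Z_j$ and $1\le s\le n$ let $L_{u,s}=\{(ua_s^r)': r\in\mathbb Z\}$. Let $Y_j=Z_j\cup\bigcup_{u\in Z_j,\,1\le s\le n}L_{u,s}$ and $Y=Z\cup\bigcup_jY_j$. (The sets $Y_j$ are pairwise disjoint.) Step 3: Let $\Gamma_0=\Gamma$. Inductively, $\Gamma_j$ is obtained from $\Gamma_{j-1}$ by removing all vertices $v$ at edge-distance $1$ from $Y_j$, unless $v$ is connected to $Y_j$ by an edge labeled $a_1$ or $a_2$ (in either direction), along with all edges incident to $v$ and all vertices and edges of $\Gamma_{j-1}$ separated from $Y_j$ in $\Gamma_{j-1}$ by $v$. Each $\Gamma_j$ is a subtree containing $Y$. Step 4: $\Gamma^*$ is obtained from $\bigcap_j\Gamma_j$ by removing all vertices $v$ (and incident edges) of the reduced form $v=ua_k^{\pm1}w$, where $u$ is a vertex of $\bigcap_j\Gamma_j$ of infinite valence, $k\notin\{1,2\}$ and $w\in\mathcal W$. For every vertex $v$ of the tree $\Gamma^*$ there is a finite set $E_v\subseteq\mathbb N$ such that the directed edges of $\Gamma^*$ terminating at $v$ are labeled exactly by $\{a_i:i\in E_v\}$ (one each), and likewise for the directed edges emanating from $v$. Step 5: For every vertex $v$ of $\Gamma^*$ and every $i\in\mathbb N\setminus E_v$ add a directed loop from $v$ to $v$ labeled $a_i$. The geometric realization of the resulting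 graph is $\widehat{\mathbb H}$, with base point the vertex $\mathbf 1$. **The map $q$ and the topology of $\widehat{\mathbb H}$.** In $\mathbb H$ put $V_i^-=l_i([0,3/8))$, $V_i^+=l_i((5/8,1])$, $U_i=l_i((1/4,3/4))$ and $U_{n+1}^\infty=\bigcup_{i=1}^n(V_i^-\cup V_i^+)\cup\bigcup_{i\ge n+1}C_i$. For a directed edge (or loop) $e$ of $\widehat{\mathbb H}$ labeled $a_i$ with parametrization $\psi_e:[0,1]\to e$, put $V_e^-=\psi_e([0,3/8))$, $V_e^+=\psi_e((5/8,1])$, $U_e=\psi_e((1/4,3/4))$. The map $q:\widehat{\mathbb H}\to\mathbb H$ is given by $q(\psi_e(t))=l_i(t)$ for every edge or loop $e$ labeled $a_i$ (so vertices map to $\mathbf 0$). For a vertex $v$, with $n\ge2$ minimal such that $E_v\subseteq\{1,\dots,n\}$, let $U_v$ be the union of all $V_e^-$ with $e$ an edge or loop emanating from $v$, all $V_e^+$ with $e$ an edge or loop terminating at $v$, and all entire loops at $v$ labeled $a_i$ with $i>n$; $q$ restricts to bijections $U_e\to U_i$ and $U_v\to U_{n+1}^\infty$. $\widehat{\mathbb H}$ carries the unique topology making all $U_e$ and $U_v$ open and all the restrictions $q|_{U_e}:U_e\to U_i$ and $q|_{U_v}:U_v\to U_{n+1}^\infty$ homeomorphisms. *)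

theory Defs
  imports "HOL-Analysis.Analysis" "Graph_Theory.Graph_Theory"
begin

section \<open>Local homeomorphisms\<close>

definition local_homeomorphism :: "'a topology \<Rightarrow> 'b topology \<Rightarrow> ('a \<Rightarrow> 'b) \<Rightarrow> bool" where
  "local_homeomorphism X Y f \<longleftrightarrow>
     (\<forall>x \<in> topspace X. \<exists>U. openin X U \<and> x \<in> U \<and> openin Y (f ` U) \<and>
        homeomorphic_map (subtopology X U) (subtopology Y (f ` U)) f)"


section \<open>The Hawaiian earring\<close>

definition circle :: "nat \<Rightarrow> (real \<times> real) set" where
  "circle i = {(x, y). x\<^sup>2 + (y - 1 / real i)\<^sup>2 = 1 / (real i)\<^sup>2}"

definition hawaiian :: "(real \<times> real) set" where
  "hawaiian = (\<Union>i\<in>{1..}. circle i)"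

abbreviation hawaiian_top :: "(real \<times> real) topology" where
  "hawaiian_top \<equiv> top_of_set hawaiian"

definition circle_loop :: "nat \<Rightarrow> real \<Rightarrow> real \<times> real" where
  "circle_loop i t = (sin (2 * pi * t) / real i, (1 - cos (2 * pi * t)) / real i)"

definition circle_Vminus :: "nat \<Rightarrow> (real \<times> real) set" where
  "circle_Vminus i = circle_loop i ` {0..<3/8}"

definition circle_Vplus :: "nat \<Rightarrow> (real \<times> real) set" where
  "circle_Vplus i = circle_loop i ` {5/8<..1}"

definition circle_U :: "nat \<Rightarrow> (real \<times> real) set" where
  "circle_U i = circle_loop i ` {1/4<..<3/4}"

text \<open>\<^term>\<open>hawaiian_U n\<close> is the set written $U_{n+1}^\infty$ (note the index shift).\<close>

definition hawaiian_U :: "nat \<Rightarrow> (real \<times> real) set" where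
  "hawaiian_U n =
     (\<Union>i\<in>{1..n}. circle_Vminus i \<union> circle_Vplus i) \<union> (\<Union>i\<in>{n+1..}. circle i)"


section \<open>Words and free reduction\<close>

text \<open>The letter \<open>(i, True)\<close> stands for $a_i$ and \<open>(i, False)\<close> for $a_i^{-1}$; only indices
  \<open>i \<ge> 1\<close> are letters of the alphabet.\<close>

type_synonym letter = "nat \<times> bool"
type_synonym word = "letter list"

definition inv_letter :: "letter \<Rightarrow> letter" where
  "inv_letter x = (fst x, \<not> snd x)"

definition words_upto :: "nat \<Rightarrow> word set" where
  "words_upto n = {x. \<forall>a \<in> set x. 1 \<le> fst a \<and> fst a \<le> n}"

definition all_words :: "word set" where
  "all_words = (\<Union>n. words_upto n)"

definition reduced :: "word \<Rightarrow> bool" where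
  "reduced u \<longleftrightarrow> successively (\<lambda>a b. b \<noteq> inv_letter a) u"

fun cancel_Cons :: "letter \<Rightarrow> word \<Rightarrow> word" where
  "cancel_Cons a [] = [a]"
| "cancel_Cons a (b # u) = (if b = inv_letter a then u else a # b # u)"

definition red :: "word \<Rightarrow> word" where
  "red x = foldr cancel_Cons x []"

inductive cancels :: "word \<Rightarrow> word \<Rightarrow> bool" where
  "cancels (x @ [a, inv_letter a] @ y) (x @ y)"

lemma reduced_red: "reduced (red x)"
proof (induction x)
  case (Cons a x)
  have "reduced (cancel_Cons a u)" if "reduced u" for u
    using that by (cases u) (auto simp: reduced_def successively_Cons)
  then show ?case using Cons by (simp add: red_def)
qed (simp add: red_def reduced_def)

text \<open>\<^const>\<open>red\<close> is obtained from its argument by cancelling adjacent inverse letters, and it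
  is the only reduced word that can be obtained in this way.\<close>

lemma cancels_Cons: "cancels x y \<Longrightarrow> cancels (a # x) (a # y)"
  by (metis append_Cons cancels.simps)

lemma cancels_red: "cancels\<^sup>*\<^sup>* x (red x)"
proof (induction x)
  case (Cons a x)
  from Cons have "cancels\<^sup>*\<^sup>* (a # x) (a # red x)"
    by (induction rule: rtranclp_induct) (auto intro: cancels_Cons rtranclp.rtrancl_into_rtrancl)
  moreover have "cancels\<^sup>*\<^sup>* (a # u) (cancel_Cons a u)" for u
  proof (cases u)
    case (Cons b v)
    then show ?thesis using cancels.intros[of "[]" a v] by auto
  qed simp
  ultimately show ?case by (simp add: red_def) (metis rtranclp_trans)
qed (simp add: red_def)

lemma red_reduced: "reduced x \<Longrightarrow> red x = x"
proof (induction x)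
  case (Cons a x)
  then show ?case by (cases x) (auto simp: red_def reduced_def successively_Cons)
qed (simp add: red_def)

lemma red_cancels: "cancels x y \<Longrightarrow> red x = red y"
proof (induction rule: cancels.induct)
  case (1 x a y)
  have i: "inv_letter (inv_letter a) = a" by (simp add: inv_letter_def)
  have *: "cancel_Cons a (cancel_Cons (inv_letter a) u) = u" if "reduced u" for u
  proof (cases u)
    case (Cons b v)
    then show ?thesis using that i
      by (cases v) (auto simp: reduced_def successively_Cons)
  qed simp
  show ?case
    using *[OF reduced_red[of y]] by (simp add: red_def)
qed

lemma red_unique:
  assumes "cancels\<^sup>*\<^sup>* x y" "reduced y"
  shows "y = red x"
proof -
  from assms(1) have "red x = red y"
    by (induction rule: rtranclp_induct) (auto dest: red_cancels)
  then show ?thesis using assms(2) by (simp add: red_reduced)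
qed


section \<open>The Cayley tree\<close>

text \<open>The arc \<open>(u, i)\<close> is the directed edge labelled $a_i$ from $u$ to $(u a_i)'$.\<close>

definition cayley :: "(word, word \<times> nat) pre_digraph" where
  "cayley = \<lparr>
     verts = {u \<in> all_words. reduced u},
     arcs = {u \<in> all_words. reduced u} \<times> {1..},
     tail = fst,
     head = (\<lambda>(u, i). red (u @ [(i, True)])) \<rparr>"

definition arc_label :: "word \<times> nat \<Rightarrow> nat" where
  "arc_label = snd"


section \<open>The sets $Y_j$\<close>

text \<open>Throughout, \<open>ws 1, ws 2, \<dots>\<close> is the chosen list of non-empty words; \<open>ws 0\<close> is never
  used.\<close>

definition alt_word :: "nat \<Rightarrow> word" where
  "alt_word m = map (\<lambda>k. (if even k then 1 else 2, True)) [0..<m]"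

definition hat_word :: "(nat \<Rightarrow> word) \<Rightarrow> nat \<Rightarrow> word" where
  "hat_word ws j = alt_word (2 * (\<Sum>k\<in>{1..<j}. length (ws k)) + 3 * j + length (ws j))"

definition Zj :: "(nat \<Rightarrow> word) \<Rightarrow> nat \<Rightarrow> word set" where
  "Zj ws j = {red (hat_word ws j @ take i (ws j)) | i. i \<le> length (ws j)}"

definition word_rank :: "word \<Rightarrow> nat" where
  "word_rank x = (LEAST n. 2 \<le> n \<and> x \<in> words_upto n)"

definition letter_power :: "nat \<Rightarrow> int \<Rightarrow> word" where
  "letter_power s r = replicate (nat \<bar>r\<bar>) (s, 0 \<le> r)"

definition line :: "word \<Rightarrow> nat \<Rightarrow> word set" where
  "line u s = {red (u @ letter_power s r) | r. True}"

definition Yj :: "(nat \<Rightarrow> word) \<Rightarrow> nat \<Rightarrow> word set" where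
  "Yj ws j = Zj ws j \<union> (\<Union>u\<in>Zj ws j. \<Union>s\<in>{1..word_rank (ws j)}. line u s)"


section \<open>Pruning the Cayley tree\<close>

definition joins :: "('a, 'b) pre_digraph \<Rightarrow> 'b \<Rightarrow> 'a \<Rightarrow> 'a \<Rightarrow> bool" where
  "joins G e u v \<longleftrightarrow> e \<in> arcs G \<and>
     (tail G e = u \<and> head G e = v \<or> tail G e = v \<and> head G e = u)"

definition cut_verts :: "(word, word \<times> nat) pre_digraph \<Rightarrow> word set \<Rightarrow> word set" where
  "cut_verts G Y = {v \<in> verts G - Y.
     (\<exists>y\<in>Y. \<exists>e. joins G e v y) \<and>
     \<not> (\<exists>y\<in>Y. \<exists>e. joins G e v y \<and> arc_label e \<in> {1, 2})}"

definition separated :: "('a, 'b) pre_digraph \<Rightarrow> 'a set \<Rightarrow> 'a \<Rightarrow> 'a set" where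
  "separated G Y v = {x \<in> verts G - {v}.
     \<not> (\<exists>y\<in>Y. x \<rightarrow>\<^sup>*\<^bsub>with_proj (mk_symmetric (G \<restriction> (verts G - {v})))\<^esub> y)}"

definition prune :: "(word, word \<times> nat) pre_digraph \<Rightarrow> word set \<Rightarrow> (word, word \<times> nat) pre_digraph" where
  "prune G Y = G \<restriction> (verts G - (\<Union>v\<in>cut_verts G Y. insert v (separated G Y v)))"

fun Gam :: "(nat \<Rightarrow> word) \<Rightarrow> nat \<Rightarrow> (word, word \<times> nat) pre_digraph" where
  "Gam ws 0 = cayley"
| "Gam ws (Suc j) = prune (Gam ws j) (Yj ws (Suc j))"

definition Gam_Inter :: "(nat \<Rightarrow> word) \<Rightarrow> (word, word \<times> nat) pre_digraph" where
  "Gam_Inter ws = \<lparr>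
     verts = (\<Inter>j. verts (Gam ws j)),
     arcs = (\<Inter>j. arcs (Gam ws j)),
     tail = tail cayley,
     head = head cayley \<rparr>"

definition infinite_valence :: "('a, 'b) pre_digraph \<Rightarrow> 'a \<Rightarrow> bool" where
  "infinite_valence G u \<longleftrightarrow> infinite (in_arcs G u \<union> out_arcs G u)"

text \<open>Vertices are reduced words, so \<open>v = u @ (k, b) # x\<close> says that $u a_k^{\pm 1} x$ is the
  reduced form of \<open>v\<close>.\<close>

definition Gam_star :: "(nat \<Rightarrow> word) \<Rightarrow> (word, word \<times> nat) pre_digraph" where
  "Gam_star ws = Gam_Inter ws \<restriction> {v \<in> verts (Gam_Inter ws).
     \<not> (\<exists>u k b x. u \<in> verts (Gam_Inter ws) \<and> infinite_valence (Gam_Inter ws) u \<and>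
          k \<notin> {1, 2} \<and> x \<in> all_words \<and> v = u @ (k, b) # x)}"


section \<open>The graph $\widehat{\mathbb H}$ and its geometric realization\<close>

text \<open>The set $E_v$ is read off from the edges terminating at \<open>v\<close>.\<close>

definition label_set :: "(nat \<Rightarrow> word) \<Rightarrow> word \<Rightarrow> nat set" where
  "label_set ws v = arc_label ` in_arcs (Gam_star ws) v"

datatype hhat_arc = Tree_Edge "word \<times> nat" | Loop word nat

fun hhat_label :: "hhat_arc \<Rightarrow> nat" where
  "hhat_label (Tree_Edge e) = arc_label e"
| "hhat_label (Loop v i) = i"

definition hhat_graph :: "(nat \<Rightarrow> word) \<Rightarrow> (word, hhat_arc) pre_digraph" where
  "hhat_graph ws = \<lparr>
     verts = verts (Gam_star ws),
     arcs = Tree_Edge ` arcs (Gam_star ws) \<union>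
            {Loop v i | v i. v \<in> verts (Gam_star ws) \<and> 1 \<le> i \<and> i \<notin> label_set ws v},
     tail = (\<lambda>e. case e of Tree_Edge d \<Rightarrow> tail (Gam_star ws) d | Loop v i \<Rightarrow> v),
     head = (\<lambda>e. case e of Tree_Edge d \<Rightarrow> head (Gam_star ws) d | Loop v i \<Rightarrow> v) \<rparr>"

text \<open>A point of the realization is either a vertex or an interior point of a unique edge,
  the latter given by its parameter in the open unit interval.\<close>

datatype hhat_point = Vertex word | Interior hhat_arc real

definition hhat :: "(nat \<Rightarrow> word) \<Rightarrow> hhat_point set" where
  "hhat ws = Vertex ` verts (hhat_graph ws) \<union>
     {Interior e t | e t. e \<in> arcs (hhat_graph ws) \<and> 0 < t \<and> t < 1}"

definition hhat_param :: "(nat \<Rightarrow> word) \<Rightarrow> hhat_arc \<Rightarrow> real \<Rightarrow> hhat_point" where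
  "hhat_param ws e t =
     (if t = 0 then Vertex (tail (hhat_graph ws) e)
      else if t = 1 then Vertex (head (hhat_graph ws) e)
      else Interior e t)"

fun hhat_q :: "hhat_point \<Rightarrow> real \<times> real" where
  "hhat_q (Vertex v) = (0, 0)"
| "hhat_q (Interior e t) = circle_loop (hhat_label e) t"

lemma hhat_q_param: "hhat_q (hhat_param ws e t) = circle_loop (hhat_label e) t"
  by (auto simp: hhat_param_def circle_loop_def)


section \<open>The topology of $\widehat{\mathbb H}$\<close>

definition arc_Vminus :: "(nat \<Rightarrow> word) \<Rightarrow> hhat_arc \<Rightarrow> hhat_point set" where
  "arc_Vminus ws e = hhat_param ws e ` {0..<3/8}"

definition arc_Vplus :: "(nat \<Rightarrow> word) \<Rightarrow> hhat_arc \<Rightarrow> hhat_point set" where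
  "arc_Vplus ws e = hhat_param ws e ` {5/8<..1}"

definition arc_U :: "(nat \<Rightarrow> word) \<Rightarrow> hhat_arc \<Rightarrow> hhat_point set" where
  "arc_U ws e = hhat_param ws e ` {1/4<..<3/4}"

definition vertex_rank :: "(nat \<Rightarrow> word) \<Rightarrow> word \<Rightarrow> nat" where
  "vertex_rank ws v = (LEAST n. 2 \<le> n \<and> label_set ws v \<subseteq> {1..n})"

definition vertex_U :: "(nat \<Rightarrow> word) \<Rightarrow> word \<Rightarrow> hhat_point set" where
  "vertex_U ws v =
     (\<Union>e\<in>out_arcs (hhat_graph ws) v. arc_Vminus ws e) \<union>
     (\<Union>e\<in>in_arcs (hhat_graph ws) v. arc_Vplus ws e) \<union>
     (\<Union>i\<in>{i. vertex_rank ws v < i \<and> Loop v i \<in> arcs (hhat_graph ws)}.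
        hhat_param ws (Loop v i) ` {0..1})"

definition is_hhat_top :: "(nat \<Rightarrow> word) \<Rightarrow> hhat_point topology \<Rightarrow> bool" where
  "is_hhat_top ws T \<longleftrightarrow> topspace T = hhat ws \<and>
     (\<forall>e\<in>arcs (hhat_graph ws). openin T (arc_U ws e) \<and>
        homeomorphic_map (subtopology T (arc_U ws e))
          (subtopology hawaiian_top (circle_U (hhat_label e))) hhat_q) \<and>
     (\<forall>v\<in>verts (hhat_graph ws). openin T (vertex_U ws v) \<and>
        homeomorphic_map (subtopology T (vertex_U ws v))
          (subtopology hawaiian_top (hawaiian_U (vertex_rank ws v))) hhat_q)"

definition hhat_top :: "(nat \<Rightarrow> word) \<Rightarrow> hhat_point topology" where
  "hhat_top ws = (THE T. is_hhat_top ws T)"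

end

theory Submission
  imports Defs
begin

text \<open>
  Once the topology of $\widehat{\mathbb H}$ is known to exist and to be unique, the sets $U_e$ and
  $U_v$ are the required neighbourhoods. It exists because \<open>q\<close> is injective on each of them and
  maps their pairwise intersections to open subsets of $\mathbb H$. The substantial point is that
  \<open>q\<close> maps $U_v$ bijectively onto $U_{n+1}^\infty$, for which the edges of $\Gamma^*$ entering and
  leaving \<open>v\<close> must carry the same finite set of labels. This is a local computation in the tree:
  a neighbour of a surviving vertex \<open>v\<close> across an edge labelled $a_s$ is pruned at step \<open>j\<close> iff
  \<open>v\<close> lies in $Y_j$, the neighbour does not, and $s \notin \{1, 2\}$; and if \<open>v\<close> and $v a_s$ lie
  in $Y_j$ then so does $v a_s^{-1}$. Vertices outside all $Y_j$ have infinite valence and retain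
  exactly the labels 1 and 2.
\<close>

section \<open>Free reduction\<close>

text \<open>Pruning deletes whole branches, so whether a vertex survives depends on the global shape
  of \<open>Gam ws j\<close>. What makes the question local is that separation by \<open>c\<close>
  spreads across every edge avoiding \<open>c\<close>. Hence a neighbour \<open>w\<close> of a
  survivor \<open>v\<close> can only disappear by being a cut vertex itself, and a vertex outside
  the subtree \<open>Y\<close> touches it along at most one edge, here the one to \<open>v\<close>.
  Subtrees are handled through directions, so no geodesics or cycles need to be constructed.

  The passage from \<open>v a_s\<close> to \<open>v a_s^{-1}\<close> inside \<open>Y_j\<close>
  reflects the shape of \<open>Y_j\<close>, a finite path \<open>Z_j\<close> with complete lines
  attached. At a point of \<open>Z_j\<close> lines in all admissible labels are present; any other
  point has no neighbours in \<open>Y_j\<close> except along the line on which it lies.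

  Existence and uniqueness of the topology share one criterion: \<open>W\<close> is open iff
  \<open>q\<close> maps its trace on every chart to an open set. Read as a property it gives
  uniqueness, read as a definition it gives existence.\<close>

definition inv_word :: "word \<Rightarrow> word" where
  "inv_word w = rev (map inv_letter w)"

lemma inv_letter_inv_letter [simp]: "inv_letter (inv_letter a) = a"
  by (simp add: inv_letter_def)

lemma inv_letter_Pair [simp]: "inv_letter (i, b) = (i, \<not> b)"
  by (simp add: inv_letter_def)

lemma fst_inv_letter [simp]: "fst (inv_letter a) = fst a"
  by (simp add: inv_letter_def)

lemma inv_word_simps [simp]:
  "inv_word [] = []" "inv_word (a # w) = inv_word w @ [inv_letter a]"
  "inv_word (v @ w) = inv_word w @ inv_word v" "inv_word (inv_word w) = w"
  by (simp_all add: inv_word_def rev_map comp_def)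

lemma inv_word_replicate [simp]: "inv_word (replicate m a) = replicate m (inv_letter a)"
  by (simp add: inv_word_def)

lemma red_Nil [simp]: "red [] = []"
  and red_Cons: "red (a # x) = cancel_Cons a (red x)"
  and red_single [simp]: "red [a] = [a]"
  by (simp_all add: red_def)

lemma red_red [simp]: "red (red x) = red x"
  by (simp add: red_reduced reduced_red)

lemma red_append_red_right [simp]: "red (x @ red y) = red (x @ y)"
  by (induction x) (simp_all add: red_Cons)

lemma cancels_append: "cancels x y \<Longrightarrow> cancels (x @ z) (y @ z)"
proof (induction rule: cancels.induct)
  case (1 x a y)
  show ?case using cancels.intros[of x a "y @ z"] by simp
qed

text \<open>\<open>red\<close> folds from the right, so induction on the word only allows reducing
  the right factor. Here confluence enters: cancelling inside \<open>x\<close> never changes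
  \<open>red (x @ y)\<close>.\<close>

lemma red_append_red_left [simp]: "red (red x @ y) = red (x @ y)"
proof -
  have "cancels\<^sup>*\<^sup>* (x @ y) (red x @ y)"
    using cancels_red[of x]
    by (induction rule: rtranclp_induct)
      (auto intro: cancels_append rtranclp.rtrancl_into_rtrancl)
  then have "red (red x @ y) = red (red (x @ y))"
    by (induction rule: rtranclp_induct) (auto dest: red_cancels)
  then show ?thesis by simp
qed

lemma red_append_red_mid [simp]: "red (x @ red y @ z) = red (x @ y @ z)"
  by (metis append.assoc red_append_red_left red_append_red_right)

lemma red_inv_word [simp]: "red (w @ inv_word w) = []" "red (inv_word w @ w) = []"
proof -
  have *: "red (w @ inv_word w) = []" for w
  proof (induction w)
    case (Cons a w)
    have "red (a # (w @ inv_word w) @ [inv_letter a]) = red ([a] @ red (w @ inv_word w) @ [inv_letter a])"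
      by (simp only: red_append_red_mid) simp
    then show ?case by (simp add: Cons) (simp add: red_Cons)
  qed simp
  show "red (w @ inv_word w) = []" by (rule *)
  show "red (inv_word w @ w) = []" using *[of "inv_word w"] by simp
qed

lemma red_cancel_left [simp]:
  "red (inv_word w @ w @ x) = red x" "red (w @ inv_word w @ x) = red x"
  by (metis append.assoc append_Nil red_append_red_left red_inv_word)+

lemma red_cancel_right [simp]:
  "red (x @ w @ inv_word w) = red x" "red (x @ inv_word w @ w) = red x"
  by (metis append_Nil2 red_append_red_right red_inv_word)+

lemma red_cancel_letter [simp]: "red (x @ [a, inv_letter a]) = red x"
  "red (x @ [inv_letter a, a]) = red x"
  using red_cancel_right[of x "[a]"] red_cancel_right[of x "[inv_letter a]"] by simp_all

lemma red_left_inj: "red (w @ x) = red (w @ y) \<Longrightarrow> red x = red y"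
  by (metis red_append_red_right red_cancel_left(1))

lemma red_inv_eq_Nil_iff:
  assumes "reduced w" "reduced x"
  shows "red (inv_word w @ x) = [] \<longleftrightarrow> x = w"
  using assms by (metis red_inv_word(2) red_left_inj red_reduced)

lemma reduced_Nil [simp]: "reduced []"
  and reduced_single [simp]: "reduced [a]"
  by (simp_all add: reduced_def)

lemma reduced_appendD1: "reduced (x @ y) \<Longrightarrow> reduced x"
  by (simp add: reduced_def successively_append_iff)

lemma red_snoc:
  assumes "reduced z"
  shows "red (z @ [a]) = (if z \<noteq> [] \<and> last z = inv_letter a then butlast z else z @ [a])"
proof (cases "z \<noteq> [] \<and> last z = inv_letter a")
  case True
  then have "z = butlast z @ [inv_letter a]"
    by (metis append_butlast_last_id)
  moreover have "reduced (butlast z)"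
    using assms calculation reduced_appendD1 by metis
  ultimately show ?thesis using True
    by (metis append.assoc append_Cons append_Nil red_cancel_letter(2) red_reduced)
next
  case False
  then have "reduced (z @ [a])"
    using assms by (auto simp: reduced_def successively_append_iff)
  with False show ?thesis by (auto simp: red_reduced)
qed

lemma set_red: "set (red x) \<subseteq> set x"
proof (induction x)
  case (Cons a x)
  have "set (cancel_Cons a u) \<subseteq> insert a (set u)" for u
    by (cases u) auto
  with Cons show ?case by (fastforce simp: red_Cons)
qed simp

lemma set_inv_word: "set (inv_word x) = inv_letter ` set x"
  by (simp add: inv_word_def)

lemma reduced_replicate: "reduced (replicate m a)"
proof (induction m)
  case (Suc m)
  then show ?case
    by (cases m) (auto simp: reduced_def inv_letter_def prod_eq_iff)
qed simp

lemma all_words_iff: "x \<in> all_words \<longleftrightarrow> (\<forall>a\<in>set x. 1 \<le> fst a)"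
proof
  assume *: "\<forall>a\<in>set x. 1 \<le> fst a"
  have "x \<in> words_upto (Max (fst ` set x))"
    using * by (auto simp: words_upto_def intro!: Max_ge)
  then show "x \<in> all_words" by (auto simp: all_words_def)
qed (auto simp: all_words_def words_upto_def)

lemma all_words_red_snoc:
  "x \<in> all_words \<Longrightarrow> 1 \<le> s \<Longrightarrow> red (x @ [(s, b)]) \<in> all_words"
  using set_red[of "x @ [(s, b)]"] by (force simp: all_words_iff)

lemma word_rank_props:
  assumes "x \<in> all_words"
  shows "2 \<le> word_rank x" "x \<in> words_upto (word_rank x)"
proof -
  obtain n where "x \<in> words_upto n" using assms by (auto simp: all_words_def)
  then have "2 \<le> max 2 n \<and> x \<in> words_upto (max 2 n)"
    by (force simp: words_upto_def)
  from LeastI[of "\<lambda>n. 2 \<le> n \<and> x \<in> words_upto n", OF this]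
  show "2 \<le> word_rank x" "x \<in> words_upto (word_rank x)"
    by (simp_all add: word_rank_def)
qed


section \<open>Directions in the Cayley tree\<close>

text \<open>The label of the first edge on the geodesic from \<open>w\<close> to \<open>x\<close>. It is constant along every
  path that avoids \<open>w\<close>; this is the only form in which acyclicity of the Cayley graph is needed.\<close>

definition direction :: "word \<Rightarrow> word \<Rightarrow> letter" where
  "direction w x = hd (red (inv_word w @ x))"

lemma direction_neighbour [simp]: "direction w (red (w @ [a])) = a"
  by (simp add: direction_def)

text \<open>In the coordinate \<open>red (inv_word w @ x)\<close> the step acts at the far end of
  the word. The first letter could change only if the word became empty, that is, if the path met
  \<open>w\<close>; at \<open>w\<close> itself \<open>direction\<close> is the unspecified
  \<open>hd []\<close>.\<close>

lemma direction_step: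
  assumes "reduced w" "reduced x" "x \<noteq> w" "red (x @ [a]) \<noteq> w"
  shows "direction w (red (x @ [a])) = direction w x"
proof -
  let ?z = "red (inv_word w @ x)"
  have z: "?z \<noteq> []" using assms red_inv_eq_Nil_iff by blast
  have "red (inv_word w @ red (x @ [a])) \<noteq> []"
    using assms red_inv_eq_Nil_iff reduced_red by blast
  moreover have *: "red (inv_word w @ red (x @ [a])) = red (?z @ [a])"
    by (simp del: append_assoc add: append_assoc[symmetric])
  ultimately have "red (?z @ [a]) \<noteq> []" by simp
  then have "hd (red (?z @ [a])) = hd ?z"
    using z red_snoc[OF reduced_red, of "inv_word w @ x" a]
    by (auto simp: hd_append split: if_splits) (metis append_butlast_last_id hd_append2)
  then show ?thesis unfolding direction_def * .
qed

text \<open>Connectedness of a vertex set in a tree, expressed by directions: no vertex outside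
  \<open>Y\<close> lies between two points of \<open>Y\<close>.\<close>

definition dir_connected :: "word set \<Rightarrow> bool" where
  "dir_connected Y \<longleftrightarrow> (\<forall>y\<in>Y. reduced y) \<and>
     (\<forall>w. reduced w \<longrightarrow> w \<notin> Y \<longrightarrow> (\<forall>x\<in>Y. \<forall>y\<in>Y. direction w x = direction w y))"

lemma dir_connectedD:
  "dir_connected Y \<Longrightarrow> y \<in> Y \<Longrightarrow> reduced y"
  "dir_connected Y \<Longrightarrow> reduced w \<Longrightarrow> w \<notin> Y \<Longrightarrow> x \<in> Y \<Longrightarrow> y \<in> Y \<Longrightarrow>
    direction w x = direction w y"
  unfolding dir_connected_def by blast+


section \<open>The sets $Y_j$ as subtrees\<close>

text \<open>With a natural exponent and a sign in place of an integer, walking along the line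
  becomes induction on \<open>m\<close>.\<close>

lemma line_eq: "line u s = {red (u @ replicate m (s, b)) | m b. True}"
proof (intro equalityI subsetI)
  fix x assume "x \<in> {red (u @ replicate m (s, b)) | m b. True}"
  then obtain m b where x: "x = red (u @ replicate m (s, b))" by auto
  show "x \<in> line u s"
  proof (cases "m = 0")
    case True
    then show ?thesis using x
      by (auto simp: line_def letter_power_def intro!: exI[of _ 0])
  next
    case False
    then have "replicate m (s, b) = letter_power s (if b then int m else - int m)"
      by (simp add: letter_power_def)
    then show ?thesis using x by (auto simp: line_def)
  qed
qed (auto simp: line_def letter_power_def)

lemma line_self: "reduced u \<Longrightarrow> u \<in> line u s"
  unfolding line_eq by (force simp: red_reduced intro: exI[of _ 0])

lemma line_step:
  assumes "x \<in> line u s"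
  shows "red (x @ [(s, c)]) \<in> line u s"
proof -
  obtain m b where x: "x = red (u @ replicate m (s, b))"
    using assms by (auto simp: line_eq)
  consider "c = b" | "m = 0" | k where "m = Suc k" "c \<noteq> b"
    by (cases m) auto
  then show ?thesis
  proof cases
    case 1
    then have "red (x @ [(s, c)]) = red (u @ replicate (Suc m) (s, b))"
      by (simp add: x replicate_append_same)
    then show ?thesis unfolding line_eq by blast
  next
    case 2
    then have "red (x @ [(s, c)]) = red (u @ replicate (Suc 0) (s, c))"
      by (simp add: x)
    then show ?thesis unfolding line_eq by blast
  next
    case 3
    then have "red (x @ [(s, c)]) = red ((u @ replicate k (s, b)) @ [(s, b), inv_letter (s, b)])"
      by (simp add: x replicate_append_same[symmetric] del: red_cancel_letter)
    then have "red (x @ [(s, c)]) = red (u @ replicate k (s, b))"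
      unfolding red_cancel_letter .
    then show ?thesis unfolding line_eq by blast
  qed
qed

lemma direction_line:
  assumes "reduced w" "reduced u" "w \<notin> line u s" "y \<in> line u s"
  shows "direction w y = direction w u"
proof -
  obtain m b where y: "y = red (u @ replicate m (s, b))"
    using assms by (auto simp: line_eq)
  have "direction w (red (u @ replicate m (s, b))) = direction w u"
  proof (induction m)
    case (Suc m)
    have *: "red (u @ replicate m' (s, b)) \<noteq> w" for m'
      using assms(3) unfolding line_eq by blast
    have "red (u @ replicate (Suc m) (s, b)) = red (red (u @ replicate m (s, b)) @ [(s, b)])"
      by (simp add: replicate_append_same)
    then show ?case
      using direction_step[OF assms(1) reduced_red *[of m], of "(s, b)"] *[of "Suc m"] Suc
      by simp
  qed (simp add: assms red_reduced)
  then show ?thesis by (simp add: y)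
qed

lemma dir_connected_Zj: "dir_connected (Zj ws j)"
  unfolding dir_connected_def
proof (intro conjI allI impI ballI)
  fix w x y
  assume w: "reduced w" "w \<notin> Zj ws j" and "x \<in> Zj ws j" "y \<in> Zj ws j"
  have "direction w (red (hat_word ws j @ take i (ws j))) = direction w (red (hat_word ws j))"
    if "i \<le> length (ws j)" for i
    using that
  proof (induction i)
    case (Suc i)
    have *: "red (hat_word ws j @ take i' (ws j)) \<noteq> w" if "i' \<le> length (ws j)" for i'
      using w(2) that unfolding Zj_def by blast
    have "red (hat_word ws j @ take (Suc i) (ws j)) =
        red (red (hat_word ws j @ take i (ws j)) @ [ws j ! i])"
      using Suc.prems by (simp add: take_Suc_conv_app_nth)
    then show ?case
      using direction_step[OF w(1) reduced_red *[of i], of "ws j ! i"] *[of "Suc i"] Suc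
      by simp
  qed simp
  with \<open>x \<in> Zj ws j\<close> \<open>y \<in> Zj ws j\<close> show "direction w x = direction w y"
    by (auto simp: Zj_def)
qed (auto simp: Zj_def reduced_red)

text \<open>Lets \<open>Z_j\<close> and the attached lines be treated alike: a point of
  \<open>Z_j\<close> lies on its own line with label 1, which is attached because
  \<open>word_rank\<close> is at least 2.\<close>

lemma Yj_E:
  assumes "y \<in> Yj ws j" "ws j \<in> all_words"
  obtains u s where "u \<in> Zj ws j" "1 \<le> s" "s \<le> word_rank (ws j)" "y \<in> line u s" "line u s \<subseteq> Yj ws j"
proof -
  have "2 \<le> word_rank (ws j)" using assms(2) by (rule word_rank_props)
  moreover have "y \<in> line y s" if "y \<in> Zj ws j" for s
    using that dir_connected_Zj dir_connectedD(1) line_self by blast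
  ultimately show thesis
    using assms(1) that[of y 1] that unfolding Yj_def by fastforce
qed

lemma dir_connected_Yj:
  assumes "ws j \<in> all_words"
  shows "dir_connected (Yj ws j)"
  unfolding dir_connected_def
proof (intro conjI allI impI ballI)
  fix y assume "y \<in> Yj ws j"
  then show "reduced y"
    using assms by (auto elim!: Yj_E simp: line_eq reduced_red)
next
  fix w x y
  assume w: "reduced w" "w \<notin> Yj ws j" and xy: "x \<in> Yj ws j" "y \<in> Yj ws j"
  \<comment> \<open>Slide \<open>z\<close> along its line into \<open>Z_j\<close>; the line stays
    inside \<open>Y_j\<close> and so avoids \<open>w\<close>.\<close>
  have *: "\<exists>u\<in>Zj ws j. direction w z = direction w u" if z: "z \<in> Yj ws j" for z
  proof -
    obtain u s where u: "u \<in> Zj ws j" "z \<in> line u s" "line u s \<subseteq> Yj ws j"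
      using Yj_E[OF z assms] by metis
    with w direction_line[of w u s z] dir_connectedD(1)[OF dir_connected_Zj u(1)]
    show ?thesis by blast
  qed
  have "w \<notin> Zj ws j" using w(2) by (auto simp: Yj_def)
  then show "direction w x = direction w y"
    using *[OF xy(1)] *[OF xy(2)] dir_connectedD(2)[OF dir_connected_Zj w(1)] by metis
qed

text \<open>Every point of \<open>Y_j\<close> is \<open>hat_word ws j\<close> times a word in the
  first \<open>word_rank (ws j)\<close> letters. Two points of \<open>Y_j\<close> therefore differ
  by such a word, and free reduction introduces no new letters.\<close>

lemma Yj_label_le:
  assumes "ws j \<in> all_words" "x \<in> Yj ws j" "red (x @ [(s, b)]) \<in> Yj ws j"
  shows "1 \<le> s" "s \<le> word_rank (ws j)"
proof -
  let ?n = "word_rank (ws j)"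
  have *: "\<exists>p\<in>words_upto ?n. y = red (hat_word ws j @ p)" if y: "y \<in> Yj ws j" for y
  proof -
    obtain u t where u: "u \<in> Zj ws j" "1 \<le> t" "t \<le> ?n" "y \<in> line u t"
      using Yj_E[OF y assms(1)] by metis
    obtain i m c where "u = red (hat_word ws j @ take i (ws j))" "y = red (u @ replicate m (t, c))"
      using u by (auto simp: Zj_def line_eq)
    then have "y = red (hat_word ws j @ take i (ws j) @ replicate m (t, c))" by simp
    moreover have "take i (ws j) @ replicate m (t, c) \<in> words_upto ?n"
      using u(2,3) word_rank_props(2)[OF assms(1)]
      by (auto simp: words_upto_def dest: in_set_takeD)
    ultimately show ?thesis by blast
  qed
  obtain p p' where p: "p \<in> words_upto ?n" "p' \<in> words_upto ?n"
    "x = red (hat_word ws j @ p)" "red (x @ [(s, b)]) = red (hat_word ws j @ p')"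
    using *[OF assms(2)] *[OF assms(3)] by blast
  then have "red (hat_word ws j @ p @ [(s, b)]) = red (hat_word ws j @ p')"
    by simp
  then have "red (p @ [(s, b)]) = red p'" by (rule red_left_inj)
  then have "red (inv_word p @ p @ [(s, b)]) = red (inv_word p @ p')"
    by (metis red_append_red_right)
  then have "red (inv_word p @ p') = [(s, b)]" by simp
  then have "(s, b) \<in> set (inv_word p @ p')"
    using set_red[of "inv_word p @ p'"] by (metis list.set_intros(1) subsetD)
  then have "\<exists>a\<in>set p \<union> set p'. fst a = s"
    by (force simp: set_inv_word)
  then show "1 \<le> s" "s \<le> ?n"
    using p(1,2) by (auto simp: words_upto_def)
qed

text \<open>At a point of \<open>Z_j\<close> every admissible label has its line, which runs both
  ways. A point \<open>x\<close> outside \<open>Z_j\<close> sees all of \<open>Z_j\<close> in one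
  direction. Its own line leads there with label \<open>t\<close>, the edge to its neighbour in
  \<open>Y_j\<close> with label \<open>s\<close>; so \<open>s = t\<close>, and the line through
  \<open>x\<close> contains both neighbours.\<close>

lemma Yj_flip:
  assumes ws: "ws j \<in> all_words" and x: "x \<in> Yj ws j" and xs: "red (x @ [(s, b)]) \<in> Yj ws j"
  shows "red (x @ [(s, c)]) \<in> Yj ws j"
proof (cases "x \<in> Zj ws j")
  case True
  then have "x \<in> line x s"
    using dir_connected_Zj dir_connectedD(1) line_self by blast
  from line_step[OF this, of c] show ?thesis
    using True Yj_label_le[OF assms] by (auto simp: Yj_def)
next
  case False
  note Zred = dir_connectedD(1)[OF dir_connected_Zj]
  have xr: "reduced x" using dir_connectedD(1)[OF dir_connected_Yj[of ws j, OF ws] x] .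
  obtain u t where u: "u \<in> Zj ws j" "x \<in> line u t" "line u t \<subseteq> Yj ws j"
    using Yj_E[OF x ws] by metis
  obtain m d where m: "x = red (u @ replicate m (t, d))"
    using u by (auto simp: line_eq)
  have "m \<noteq> 0" using m False u(1) Zred by (metis append_Nil2 red_reduced replicate_0)
  have "u = red (x @ inv_word (replicate m (t, d)))"
    using m Zred[OF u(1)] by (simp add: red_reduced del: inv_word_replicate)
  then have "red (inv_word x @ u) = replicate m (t, \<not> d)"
    using reduced_replicate by (simp add: red_reduced)
  then have du: "fst (direction x u) = t"
    using \<open>m \<noteq> 0\<close> by (simp add: direction_def)
  obtain u' t' where u': "u' \<in> Zj ws j" "red (x @ [(s, b)]) \<in> line u' t'"
    using Yj_E[OF xs ws] by metis
  obtain m' d' where m': "red (x @ [(s, b)]) = red (u' @ replicate m' (t', d'))"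
    using u' by (auto simp: line_eq)
  have "u' = red (red (u' @ replicate m' (t', d')) @ inv_word (replicate m' (t', d')))"
    using Zred[OF u'(1)] by (simp add: red_reduced del: inv_word_replicate)
  then have u'_eq: "u' = red (x @ [(s, b)] @ inv_word (replicate m' (t', d')))"
    unfolding m'[symmetric] by simp
  then have "red (inv_word x @ u') = cancel_Cons (s, b) (replicate m' (t', \<not> d'))"
    using reduced_replicate by (simp add: red_Cons red_reduced)
  moreover have "red (inv_word x @ u') \<noteq> []"
    using False u'(1) Zred xr red_inv_eq_Nil_iff by blast
  \<comment> \<open>Either \<open>(s, b)\<close> stays in front, or it cancels against the power and
    then \<open>t' = s\<close>; what is left is nonempty because \<open>u'\<close> differs from
    \<open>x\<close>.\<close>
  ultimately have "fst (direction x u') = s"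
    unfolding direction_def by (cases m') (auto split: if_splits simp: gr0_conv_Suc)
  moreover have "direction x u' = direction x u"
    using dir_connectedD(2)[OF dir_connected_Zj xr False u'(1) u(1)] .
  ultimately have "s = t" using du by simp
  then show ?thesis using line_step[OF u(2), of c] u(3) by auto
qed


section \<open>Pruning\<close>

text \<open>Full subgraphs of the Cayley tree. All graphs of the pruning construction have this
  form, so questions about their edges become questions about their vertices.\<close>

definition induced :: "(word, word \<times> nat) pre_digraph \<Rightarrow> bool" where
  "induced G \<longleftrightarrow> G = cayley \<restriction> verts G \<and> verts G \<subseteq> verts cayley"

lemma cayley_simps:
  "verts cayley = {u \<in> all_words. reduced u}" "tail cayley = fst"
  "head cayley = (\<lambda>(u, i). red (u @ [(i, True)]))"
  "arcs cayley = {u \<in> all_words. reduced u} \<times> {1..}"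
  by (simp_all add: cayley_def)

lemma inducedD:
  assumes "induced G"
  shows "tail G = fst" "head G = (\<lambda>(u, i). red (u @ [(i, True)]))"
    "(u, i) \<in> arcs G \<longleftrightarrow> 1 \<le> i \<and> u \<in> verts G \<and> red (u @ [(i, True)]) \<in> verts G"
    "v \<in> verts G \<Longrightarrow> reduced v" "v \<in> verts G \<Longrightarrow> v \<in> all_words"
proof -
  from assms have G: "G = cayley \<restriction> verts G" and V: "verts G \<subseteq> verts cayley"
    unfolding induced_def by blast+
  show "tail G = fst" "head G = (\<lambda>(u, i). red (u @ [(i, True)]))"
    by (subst G; simp add: cayley_simps)+
  show "(u, i) \<in> arcs G \<longleftrightarrow> 1 \<le> i \<and> u \<in> verts G \<and> red (u @ [(i, True)]) \<in> verts G"
    using V by (subst G) (auto simp: cayley_simps)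
  show "v \<in> verts G \<Longrightarrow> reduced v" "v \<in> verts G \<Longrightarrow> v \<in> all_words"
    using V by (auto simp: cayley_simps)
qed

lemma induced_restrict:
  assumes "induced G" "V \<subseteq> verts G"
  shows "induced (G \<restriction> V)"
proof -
  have "G \<restriction> V = cayley \<restriction> V"
    using assms inducedD[OF assms(1)]
    by (auto simp: induce_subgraph_def cayley_simps)
  moreover have "V \<subseteq> verts cayley" using assms unfolding induced_def by blast
  ultimately show ?thesis unfolding induced_def by simp
qed

lemma red_snoc_snoc_inv [simp]: "red (red (v @ [(s, b)]) @ [(s, \<not> b)]) = red v"
  using red_cancel_letter(1)[of v "(s, b)"] by simp

lemma red_snoc_cases:
  assumes "reduced v"
  shows "red (v @ [(s, b)]) = v @ [(s, b)] \<or> v = red (v @ [(s, b)]) @ [(s, \<not> b)]"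
  by (metis append_butlast_last_id inv_letter_Pair red_snoc[OF assms])

lemma adjacent_sym:
  assumes "induced G" "v \<in> verts G" "w = red (v @ [(s, b)])"
  shows "v = red (w @ [(s, \<not> b)])"
  unfolding assms(3) red_snoc_snoc_inv using inducedD(4)[OF assms(1,2)] by (simp add: red_reduced)

text \<open>The sign \<open>b\<close> tells in which sense the edge is crossed from
  \<open>u\<close>. An arc is stored at its tail, which is \<open>u\<close> for the positive sense
  and \<open>v\<close> for the negative one.\<close>

lemma joins_induced:
  assumes "induced G"
  shows "joins G e u v \<longleftrightarrow> u \<in> verts G \<and> v \<in> verts G \<and> 1 \<le> arc_label e \<and>
     (\<exists>b. v = red (u @ [(arc_label e, b)]) \<and> e = (if b then u else v, arc_label e))"
proof (cases e)
  case (Pair p i)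
  have adj: "red (v @ [(i, True)]) = u \<longleftrightarrow> v = red (u @ [(i, False)])"
    if "u \<in> verts G" "v \<in> verts G"
    using adjacent_sym[OF assms that(1), of v i False] adjacent_sym[OF assms that(2), of u i True]
    unfolding not_True_eq_False not_False_eq_True by metis
  have "joins G (p, i) u v \<longleftrightarrow> 1 \<le> i \<and> p \<in> verts G \<and> red (p @ [(i, True)]) \<in> verts G \<and>
      (p = u \<and> red (p @ [(i, True)]) = v \<or> p = v \<and> red (p @ [(i, True)]) = u)"
    unfolding joins_def inducedD(1-3)[OF assms] by simp
  also have "\<dots> \<longleftrightarrow> u \<in> verts G \<and> v \<in> verts G \<and> 1 \<le> i \<and>
      (v = red (u @ [(i, True)]) \<and> p = u \<or> v = red (u @ [(i, False)]) \<and> p = v)"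
    using adj by (cases "u \<in> verts G \<and> v \<in> verts G") auto
  also have "\<dots> \<longleftrightarrow> u \<in> verts G \<and> v \<in> verts G \<and> 1 \<le> i \<and>
      (\<exists>b. v = red (u @ [(i, b)]) \<and> p = (if b then u else v))"
    by (simp only: ex_bool_eq if_True if_False)
  finally show ?thesis unfolding Pair arc_label_def by simp
qed

lemma joins_obtain:
  assumes "induced G" "u \<in> verts G" "red (u @ [(s, b)]) \<in> verts G" "1 \<le> s"
  obtains e where "joins G e u (red (u @ [(s, b)]))" "arc_label e = s"
  using assms that[of "(if b then u else red (u @ [(s, b)]), s)"]
  by (auto simp: joins_induced arc_label_def)

text \<open>Makes \<open>direction w\<close> an invariant of the components left after deleting
  \<open>w\<close>.\<close>

lemma direction_reachable:
  assumes G: "induced G" and w: "reduced w"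
    and "x \<rightarrow>\<^sup>*\<^bsub>with_proj (mk_symmetric (G \<restriction> (verts G - {w})))\<^esub> y"
  shows "direction w x = direction w y"
  using assms(3) unfolding reachable_def
proof (induction rule: rtrancl_on_induct)
  case (step y z)
  then obtain e where e: "e \<in> arcs (G \<restriction> (verts G - {w}))"
    "tail G e = y \<and> head G e = z \<or> tail G e = z \<and> head G e = y"
    by (auto simp: parcs_mk_symmetric)
  then have "joins G e y z" "y \<noteq> w" "z \<noteq> w"
    by (auto simp: joins_def)
  then show ?case
    using step.IH direction_step[OF w] inducedD(4)[OF G] by (auto simp: joins_induced[OF G])
qed simp

text \<open>A path from \<open>z\<close> to \<open>Y\<close> avoiding \<open>c\<close> could be
  prolonged by the edge to such a path from \<open>x\<close>.\<close>

lemma separated_neighbour: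
  assumes "induced G" "joins G e x z" "x \<noteq> c" "z \<noteq> c" "x \<in> separated G Y c"
  shows "z \<in> separated G Y c"
proof (rule ccontr)
  let ?H = "with_proj (mk_symmetric (G \<restriction> (verts G - {c})))"
  assume z: "z \<notin> separated G Y c"
  have xz: "x \<in> verts G" "z \<in> verts G" "e \<in> arcs G"
    using assms(2) joins_induced[OF assms(1)] unfolding joins_def by blast+
  then obtain y where y: "y \<in> Y" "z \<rightarrow>\<^sup>*\<^bsub>?H\<^esub> y"
    using z assms(4) by (auto simp: separated_def)
  have "(x, z) \<in> arcs_ends ?H"
    using assms(2-4) xz by (force simp: parcs_mk_symmetric joins_def simp del: split_paired_Ex)
  with y(2) xz assms(3) have "x \<rightarrow>\<^sup>*\<^bsub>?H\<^esub> y"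
    unfolding reachable_def by (auto intro: converse_rtrancl_on_into_rtrancl_on)
  with y(1) assms(5) show False by (auto simp: separated_def)
qed

lemma verts_prune:
  "verts (prune G Y) = verts G - (\<Union>c\<in>cut_verts G Y. insert c (separated G Y c))"
  by (simp add: prune_def)

lemma induced_prune: "induced G \<Longrightarrow> induced (prune G Y)"
  unfolding prune_def by (rule induced_restrict) auto

lemma prune_neighbour_iff:
  assumes G: "induced G" and Y: "dir_connected Y"
    and v: "v \<in> verts (prune G Y)" and w: "red (v @ [(s, b)]) \<in> verts G" and s: "1 \<le> s"
  shows "red (v @ [(s, b)]) \<in> verts (prune G Y) \<longleftrightarrow>
    (v \<in> Y \<longrightarrow> s \<in> {1, 2} \<or> red (v @ [(s, b)]) \<in> Y)"
proof -
  define w where "w = red (v @ [(s, b)])"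
  have vG: "v \<in> verts G" using v by (simp add: verts_prune)
  have wG: "w \<in> verts G" using w by (simp add: w_def)
  note wr = inducedD(4)[OF G wG]
  have vw: "v = red (w @ [(s, \<not> b)])" using adjacent_sym[OF G vG w_def] .
  obtain e where e: "joins G e w v" "arc_label e = s"
    using joins_obtain[OF G wG, of s "\<not> b"] vG s unfolding vw[symmetric] by blast
  \<comment> \<open>The first letter towards \<open>y\<close> is the whole edge from
    \<open>w\<close> to \<open>y\<close>, so the direction already determines its label.\<close>
  have label: "arc_label d = s" if d: "joins G d w y" "direction w y = direction w v" for y d
  proof -
    obtain c where "y = red (w @ [(arc_label d, c)])"
      using d(1) by (auto simp: joins_induced[OF G])
    then show ?thesis using d(2) direction_neighbour vw by (metis Pair_inject)
  qed
  have "w \<notin> verts (prune G Y) \<longleftrightarrow> v \<in> Y \<and> s \<notin> {1, 2} \<and> w \<notin> Y"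
  proof
    assume *: "v \<in> Y \<and> s \<notin> {1, 2} \<and> w \<notin> Y"
    then have v': "v \<in> Y" "s \<notin> {1, 2}" "w \<notin> Y" by auto
    \<comment> \<open>As \<open>w\<close> lies outside \<open>Y\<close>, all of \<open>Y\<close>
      lies in the direction of \<open>v\<close>, and every edge from \<open>w\<close> to
      \<open>Y\<close> has the label \<open>s\<close>.\<close>
    have "arc_label d \<notin> {1, 2}" if "y \<in> Y" "joins G d w y" for y d
      using label[OF that(2) dir_connectedD(2)[OF Y wr v'(3) that(1) v'(1)]] v'(2) by simp
    then have "w \<in> cut_verts G Y"
      using wG v'(1,3) e(1) unfolding cut_verts_def by blast
    then show "w \<notin> verts (prune G Y)" by (auto simp: verts_prune)
  next
    assume "w \<notin> verts (prune G Y)"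
    then obtain c where c: "c \<in> cut_verts G Y" "w = c \<or> w \<in> separated G Y c"
      using wG by (auto simp: verts_prune)
    have vc: "v \<noteq> c" "v \<notin> separated G Y c"
      using v c(1) by (auto simp: verts_prune)
    \<comment> \<open>Otherwise the edge to \<open>v\<close>, which avoids \<open>c\<close>, would
      make \<open>v\<close> separated as well, against its survival.\<close>
    have "w = c"
      using separated_neighbour[OF G e(1)] c(2) vc by blast
    then have w_cut: "w \<in> cut_verts G Y" and "v \<notin> separated G Y w" "v \<noteq> w"
      using c vc by auto
    \<comment> \<open>\<open>v\<close> is not separated from \<open>Y\<close> by \<open>w\<close>,
      which ties the direction of \<open>Y\<close> seen from \<open>w\<close> to that of
      \<open>v\<close>.\<close>
    then obtain y' where y': "y' \<in> Y" "direction w v = direction w y'"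
      using vG direction_reachable[OF G wr] by (auto simp: separated_def)
    obtain y d where y: "y \<in> Y" "joins G d w y" "arc_label d \<notin> {1, 2}" and "w \<notin> Y"
      using w_cut unfolding cut_verts_def by blast
    have dir: "direction w y = direction w v"
      using dir_connectedD(2)[OF Y wr \<open>w \<notin> Y\<close> y(1) y'(1)] y'(2) by simp
    then have "arc_label d = s" using label y by blast
    moreover obtain b' where "y = red (w @ [(arc_label d, b')])"
      using y(2) by (auto simp: joins_induced[OF G])
    ultimately have "y = v" using dir direction_neighbour vw by metis
    then show "v \<in> Y \<and> s \<notin> {1, 2} \<and> w \<notin> Y"
      using y \<open>arc_label d = s\<close> \<open>w \<notin> Y\<close> by auto
  qed
  then show ?thesis unfolding w_def by blast
qed

section \<open>The pruning sequence, its intersection and the valences there\<close>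

locale word_sequence =
  fixes ws :: "nat \<Rightarrow> word"
  assumes ws: "\<And>j. 1 \<le> j \<Longrightarrow> ws j \<in> all_words"
begin

lemma induced_Gam: "induced (Gam ws j)"
proof (induction j)
  case 0
  have "cayley = cayley \<restriction> verts cayley"
    by (auto simp: induce_subgraph_def cayley_def all_words_red_snoc reduced_red)
  then show ?case unfolding Gam.simps induced_def by blast
qed (simp add: induced_prune)

text \<open>Vertices never return once deleted, and step \<open>i\<close> affects an edge at
  \<open>v\<close> only through \<open>Y_i\<close>; so the conditions of the single steps
  accumulate.\<close>

lemma Gam_neighbour_iff:
  assumes "v \<in> verts (Gam ws j)" "1 \<le> s"
  shows "red (v @ [(s, b)]) \<in> verts (Gam ws j) \<longleftrightarrow>
    (\<forall>i\<in>{1..j}. v \<in> Yj ws i \<longrightarrow> s \<in> {1, 2} \<or> red (v @ [(s, b)]) \<in> Yj ws i)"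
  using assms
proof (induction j)
  case 0
  then show ?case by (simp add: cayley_simps all_words_red_snoc reduced_red)
next
  case (Suc j)
  have v: "v \<in> verts (Gam ws j)" using Suc.prems(1) by (simp add: verts_prune)
  have *: "(\<forall>i\<in>{1..Suc j}. P i) \<longleftrightarrow> P (Suc j) \<and> (\<forall>i\<in>{1..j}. P i)" for P
  proof -
    have *: "{1..Suc j} = insert (Suc j) {1..j}" by auto
    show ?thesis unfolding * by simp
  qed
  show ?case
  proof (cases "red (v @ [(s, b)]) \<in> verts (Gam ws j)")
    case True
    have "dir_connected (Yj ws (Suc j))" using ws dir_connected_Yj by simp
    from prune_neighbour_iff[OF induced_Gam this _ True Suc.prems(2)] Suc.prems(1)
    show ?thesis using True Suc.IH[OF v Suc.prems(2)] unfolding * Gam.simps by blast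
  next
    case False
    then have "red (v @ [(s, b)]) \<notin> verts (Gam ws (Suc j))" by (simp add: verts_prune)
    then show ?thesis using False Suc.IH[OF v Suc.prems(2)] unfolding * by blast
  qed
qed

lemma induced_Gam_Inter: "induced (Gam_Inter ws)"
proof -
  have V: "verts (Gam_Inter ws) = (\<Inter>j. verts (Gam ws j))" by (simp add: Gam_Inter_def)
  have "verts (Gam_Inter ws) \<subseteq> verts cayley" unfolding V by (metis Gam.simps(1) INT_lower UNIV_I)
  moreover have "arcs (Gam_Inter ws) = arcs (cayley \<restriction> verts (Gam_Inter ws))"
    using calculation inducedD(3)[OF induced_Gam] unfolding V
    by (fastforce simp: Gam_Inter_def cayley_simps)
  ultimately show ?thesis
    unfolding induced_def by (simp add: induce_subgraph_def Gam_Inter_def)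
qed

lemma Gam_Inter_neighbour_iff:
  assumes "v \<in> verts (Gam_Inter ws)" "1 \<le> s"
  shows "red (v @ [(s, b)]) \<in> verts (Gam_Inter ws) \<longleftrightarrow>
    (\<forall>i\<ge>1. v \<in> Yj ws i \<longrightarrow> s \<in> {1, 2} \<or> red (v @ [(s, b)]) \<in> Yj ws i)"
proof -
  have "v \<in> verts (Gam ws j)" for j using assms(1) by (simp add: Gam_Inter_def)
  note iff = Gam_neighbour_iff[OF this assms(2)]
  have "(\<forall>j. \<forall>i\<in>{1..j}. P i) \<longleftrightarrow> (\<forall>i\<ge>1. P i)" for P :: "nat \<Rightarrow> bool"
    by (meson atLeastAtMost_iff order_refl)
  then show ?thesis
    unfolding Gam_Inter_def pre_digraph.simps INT_iff ball_UNIV iff .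
qed

lemma Gam_Inter_label_le:
  assumes "v \<in> verts (Gam_Inter ws)" "red (v @ [(s, b)]) \<in> verts (Gam_Inter ws)" "1 \<le> s"
    and "1 \<le> i" "v \<in> Yj ws i"
  shows "s \<le> word_rank (ws i)"
proof -
  have "s \<in> {1, 2} \<or> red (v @ [(s, b)]) \<in> Yj ws i"
    using Gam_Inter_neighbour_iff[OF assms(1,3)] assms by blast
  then show ?thesis
    using word_rank_props(1)[OF ws[OF assms(4)]] Yj_label_le(2)[of ws i, OF ws[OF assms(4)] assms(5)]
    by auto
qed

text \<open>Off all \<open>Y_i\<close> no edge at \<open>v\<close> is ever lost. In
  \<open>Y_i\<close> only labels up to \<open>word_rank (ws i)\<close> remain, each on at most two
  edges.\<close>

lemma infinite_valence_iff:
  assumes v: "v \<in> verts (Gam_Inter ws)"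
  shows "infinite_valence (Gam_Inter ws) v \<longleftrightarrow> (\<forall>i\<ge>1. v \<notin> Yj ws i)"
proof
  note G = induced_Gam_Inter
  assume *: "\<forall>i\<ge>1. v \<notin> Yj ws i"
  have "Pair v ` {1..} \<subseteq> out_arcs (Gam_Inter ws) v"
    using * v Gam_Inter_neighbour_iff[OF v] by (auto simp: out_arcs_def inducedD[OF G])
  moreover have "infinite (Pair v ` {1::nat..})"
    by (simp add: finite_image_iff inj_on_def infinite_Ici)
  ultimately show "infinite_valence (Gam_Inter ws) v"
    unfolding infinite_valence_def by (meson finite_Un finite_subset)
next
  note G = induced_Gam_Inter
  assume inf: "infinite_valence (Gam_Inter ws) v"
  show "\<forall>i\<ge>1. v \<notin> Yj ws i"
  proof (intro allI impI notI)
    fix i :: nat assume i: "1 \<le> i" "v \<in> Yj ws i"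
    have "in_arcs (Gam_Inter ws) v \<union> out_arcs (Gam_Inter ws) v \<subseteq>
        (\<lambda>(s, b). (if b then v else red (v @ [(s, b)]), s)) ` ({..word_rank (ws i)} \<times> UNIV)"
    proof
      fix e assume e: "e \<in> in_arcs (Gam_Inter ws) v \<union> out_arcs (Gam_Inter ws) v"
      then obtain w where "joins (Gam_Inter ws) e v w"
        by (auto simp: joins_def in_arcs_def out_arcs_def)
      then obtain b where b: "w = red (v @ [(arc_label e, b)])" "e = (if b then v else w, arc_label e)"
        "1 \<le> arc_label e" "w \<in> verts (Gam_Inter ws)"
        by (auto simp: joins_induced[OF G])
      have "arc_label e \<le> word_rank (ws i)"
        using Gam_Inter_label_le[OF v _ b(3) i] b(1,4) by blast
      then show "e \<in> (\<lambda>(s, b). (if b then v else red (v @ [(s, b)]), s)) ` ({..word_rank (ws i)} \<times> UNIV)"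
        using b(1,2) by (intro image_eqI[of _ _ "(arc_label e, b)"]) auto
    qed
    then have "finite (in_arcs (Gam_Inter ws) v \<union> out_arcs (Gam_Inter ws) v)"
      by (rule finite_subset) simp
    with inf show False by (simp add: infinite_valence_def)
  qed
qed

section \<open>The final tree and its label sets\<close>

lemma induced_Gam_star: "induced (Gam_star ws)"
  unfolding Gam_star_def by (rule induced_restrict[OF induced_Gam_Inter]) auto

lemma verts_Gam_star:
  "v \<in> verts (Gam_star ws) \<longleftrightarrow> v \<in> verts (Gam_Inter ws) \<and>
     (\<forall>u k b x. u \<in> verts (Gam_Inter ws) \<longrightarrow> infinite_valence (Gam_Inter ws) u \<longrightarrow>
        k \<notin> {1, 2} \<longrightarrow> v \<noteq> u @ (k, b) # x)"
proof -
  have "x \<in> all_words" if "u @ (k, b) # x \<in> verts (Gam_Inter ws)" for u k b x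
    using inducedD(5)[OF induced_Gam_Inter that] by (auto simp: all_words_iff)
  then show ?thesis
    unfolding Gam_star_def induce_subgraph_verts mem_Collect_eq by blast
qed

text \<open>The removal in \<open>Gam_star\<close> can strike a neighbour of the survivor
  \<open>v\<close> only if \<open>v\<close> has infinite valence and the neighbour extends
  \<open>v\<close> by a letter other than 1, 2. Any other forbidden prefix of the neighbour would
  already be a prefix of \<open>v\<close>.\<close>

lemma Gam_star_neighbour_iff:
  assumes v: "v \<in> verts (Gam_star ws)" and s: "1 \<le> s"
  shows "red (v @ [(s, b)]) \<in> verts (Gam_star ws) \<longleftrightarrow>
    (if infinite_valence (Gam_Inter ws) v then s \<in> {1, 2}
     else \<forall>i\<ge>1. v \<in> Yj ws i \<longrightarrow> s \<in> {1, 2} \<or> red (v @ [(s, b)]) \<in> Yj ws i)"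
    (is "_ \<longleftrightarrow> ?R")
proof -
  let ?I = "Gam_Inter ws"
  define w where "w = red (v @ [(s, b)])"
  have vI: "v \<in> verts ?I" using v verts_Gam_star by blast
  note wI_iff = Gam_Inter_neighbour_iff[OF vI s, of b, folded w_def]
  have v_eq: "v = red (w @ [(s, \<not> b)])"
    using adjacent_sym[OF induced_Gam_Inter vI w_def] .
  have vr: "reduced v" using inducedD(4)[OF induced_Gam_Inter vI] .
  have star: "w \<in> verts (Gam_star ws) \<longleftrightarrow> w \<in> verts ?I \<and>
      \<not> (w = v @ [(s, b)] \<and> infinite_valence ?I v \<and> s \<notin> {1, 2})" (is "?A \<longleftrightarrow> ?B")
  proof
    assume ?A
    then show ?B using verts_Gam_star[of w] vI by blast
  next
    assume B: ?B
    have "w \<noteq> u @ (k, c) # x"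
      if u: "u \<in> verts ?I" "infinite_valence ?I u" "k \<notin> {1, 2}" for u k c x
    proof
      assume w_eq: "w = u @ (k, c) # x"
      consider "w = v @ [(s, b)]" | "v = w @ [(s, \<not> b)]"
        using red_snoc_cases[OF vr, of s b] unfolding w_def[symmetric] by blast
      then show False
      proof cases
        case 1
        show False
        proof (cases x rule: rev_exhaust)
          case Nil
          then show False using 1 w_eq B u by auto
        next
          case (snoc x' a)
          then have "v = u @ (k, c) # x'" using 1 w_eq by simp
          then show False using v u verts_Gam_star by blast
        qed
      next
        case 2
        then have "v = u @ (k, c) # (x @ [(s, \<not> b)])" using w_eq by simp
        then show False using v u verts_Gam_star by blast
      qed
    qed
    then show ?A using B verts_Gam_star by blast
  qed
  show ?thesis
  proof (cases "infinite_valence ?I v")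
    case False
    then show ?thesis using star wI_iff unfolding w_def by simp
  next
    case True
    then have vY: "\<forall>i\<ge>1. v \<notin> Yj ws i" using infinite_valence_iff[OF vI] by blast
    then have wI: "w \<in> verts ?I" using wI_iff by blast
    \<comment> \<open>If instead \<open>v\<close> extends \<open>w\<close>, then \<open>w\<close>
      has finite valence, since otherwise \<open>v\<close> would have been removed. So
      \<open>w\<close> lies in some \<open>Y_i\<close>, and the survival of \<open>v\<close> across
      a label other than 1, 2 puts \<open>v\<close> into \<open>Y_i\<close>, against its infinite
      valence.\<close>
    have "w = v @ [(s, b)]" if "w \<in> verts (Gam_star ws)" "s \<notin> {1, 2}"
    proof (rule ccontr)
      assume "w \<noteq> v @ [(s, b)]"
      then have vw: "v = w @ [(s, \<not> b)]"
        using red_snoc_cases[OF vr, of s b] unfolding w_def[symmetric] by blast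
      then have "\<not> infinite_valence ?I w"
        using v wI that(2) verts_Gam_star by blast
      then obtain i where i: "1 \<le> i" "w \<in> Yj ws i"
        using infinite_valence_iff[OF wI] by blast
      have "\<forall>i\<ge>1. w \<in> Yj ws i \<longrightarrow> s \<in> {1, 2} \<or> v \<in> Yj ws i"
        using Gam_Inter_neighbour_iff[OF wI s, of "\<not> b"] vI unfolding v_eq[symmetric] by blast
      then show False using i vY that(2) by blast
    qed
    then show ?thesis using True star wI unfolding w_def[symmetric] by auto
  qed
qed

text \<open>The criterion treats both signs alike: labels 1 and 2 are kept in either sense, and
  membership in \<open>Y_i\<close> passes to the opposite neighbour by
  \<open>Yj_flip\<close>.\<close>

lemma Gam_star_neighbour_flip:
  assumes "v \<in> verts (Gam_star ws)" "1 \<le> s" "red (v @ [(s, b)]) \<in> verts (Gam_star ws)"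
  shows "red (v @ [(s, c)]) \<in> verts (Gam_star ws)"
  using assms(3) Yj_flip[of ws _ v s b c, OF ws]
  unfolding Gam_star_neighbour_iff[OF assms(1,2)] by (auto split: if_splits)

lemma arcs_Gam_star:
  "(v, i) \<in> arcs (Gam_star ws) \<longleftrightarrow>
    1 \<le> i \<and> v \<in> verts (Gam_star ws) \<and> red (v @ [(i, True)]) \<in> verts (Gam_star ws)"
  using inducedD(3)[OF induced_Gam_star] .

text \<open>\<open>label_set\<close> is read off from incoming edges; that outgoing edges carry the
  same labels is the content of \<open>Gam_star_neighbour_flip\<close>.\<close>

lemma label_set_iff:
  assumes v: "v \<in> verts (Gam_star ws)"
  shows "i \<in> label_set ws v \<longleftrightarrow> (v, i) \<in> arcs (Gam_star ws)"
    "i \<in> label_set ws v \<longleftrightarrow> (red (v @ [(i, False)]), i) \<in> arcs (Gam_star ws)"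
proof -
  note G = induced_Gam_star
  have vr: "red v = v" using inducedD(4)[OF G v] by (rule red_reduced)
  have in_arc: "(u, i) \<in> in_arcs (Gam_star ws) v \<longleftrightarrow>
      1 \<le> i \<and> u = red (v @ [(i, False)]) \<and> u \<in> verts (Gam_star ws)" for u i
  proof -
    have "u = red (v @ [(i, False)])" if "u \<in> verts (Gam_star ws)" "red (u @ [(i, True)]) = v"
      using adjacent_sym[OF G that(1), of v i True] that(2) by simp
    moreover have "red (red (v @ [(i, False)]) @ [(i, True)]) = v"
      using red_snoc_snoc_inv[of v i False] vr by simp
    ultimately show ?thesis
      using v by (auto simp: in_arcs_def inducedD[OF G])
  qed
  have 1: "i \<in> label_set ws v \<longleftrightarrow> 1 \<le> i \<and> red (v @ [(i, False)]) \<in> verts (Gam_star ws)"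
  proof -
    have "i \<in> label_set ws v \<longleftrightarrow> (\<exists>u. (u, i) \<in> in_arcs (Gam_star ws) v)"
      by (force simp: label_set_def arc_label_def)
    then show ?thesis unfolding in_arc by blast
  qed
  show "i \<in> label_set ws v \<longleftrightarrow> (v, i) \<in> arcs (Gam_star ws)"
    unfolding 1 arcs_Gam_star using v Gam_star_neighbour_flip[OF v] by blast
  show "i \<in> label_set ws v \<longleftrightarrow> (red (v @ [(i, False)]), i) \<in> arcs (Gam_star ws)"
    unfolding 1 arcs_Gam_star using v red_snoc_snoc_inv[of v i False] vr by auto
qed

text \<open>At infinite valence only labels 1 and 2 are left; otherwise \<open>v\<close> lies in
  some \<open>Y_i\<close>, which bounds its labels. This provides the witness for the
  \<open>LEAST\<close> in \<open>vertex_rank\<close>.\<close>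

lemma label_set_bounded:
  assumes v: "v \<in> verts (Gam_star ws)"
  shows "\<exists>n\<ge>2. label_set ws v \<subseteq> {1..n}"
proof (cases "infinite_valence (Gam_Inter ws) v")
  case True
  then have "label_set ws v \<subseteq> {1..2}"
    using Gam_star_neighbour_iff[OF v, of _ True]
    by (auto simp: label_set_iff[OF v] arcs_Gam_star)
  then show ?thesis by blast
next
  case False
  have vI: "v \<in> verts (Gam_Inter ws)" using v verts_Gam_star by blast
  then obtain i where i: "1 \<le> i" "v \<in> Yj ws i"
    using False infinite_valence_iff by blast
  have "label_set ws v \<subseteq> {1..word_rank (ws i)}"
    using Gam_Inter_label_le[OF vI _ _ i, of _ True] verts_Gam_star
    by (auto simp: label_set_iff[OF v] arcs_Gam_star)
  then show ?thesis using word_rank_props(1)[OF ws[OF i(1)]] by blast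
qed

lemma label_set_vertex_rank:
  assumes v: "v \<in> verts (Gam_star ws)"
  shows "label_set ws v \<subseteq> {1..vertex_rank ws v}"
  using LeastI_ex[of "\<lambda>n. 2 \<le> n \<and> label_set ws v \<subseteq> {1..n}"] label_set_bounded[OF v]
  unfolding vertex_rank_def by blast

end


section \<open>Gluing a topology along charts\<close>

text \<open>The right-hand side mentions \<open>T\<close> only through its underlying set, so two
  topologies on one set with the same charts coincide.\<close>

lemma open_charts_determine:
  assumes cover: "\<Union>\<U> = topspace T"
    and charts: "\<And>U. U \<in> \<U> \<Longrightarrow> openin T U \<and> openin Y (q ` U) \<and>
      homeomorphic_map (subtopology T U) (subtopology Y (q ` U)) q"
  shows "openin T W \<longleftrightarrow> W \<subseteq> topspace T \<and> (\<forall>U\<in>\<U>. openin Y (q ` (W \<inter> U)))"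
proof -
  have chart: "openin T (W \<inter> U) \<longleftrightarrow> openin Y (q ` (W \<inter> U))" if "U \<in> \<U>" for U
  proof -
    have U: "openin T U" "openin Y (q ` U)"
      "homeomorphic_map (subtopology T U) (subtopology Y (q ` U)) q"
      using charts[OF that] by auto
    have "openin T (W \<inter> U) \<longleftrightarrow> openin (subtopology T U) (W \<inter> U)"
      using U(1) by (simp add: openin_open_subtopology)
    also have "\<dots> \<longleftrightarrow> openin (subtopology Y (q ` U)) (q ` (W \<inter> U))"
      using homeomorphic_map_openness[OF U(3), of "W \<inter> U"] openin_subset[OF U(1)]
      by auto
    also have "\<dots> \<longleftrightarrow> openin Y (q ` (W \<inter> U))"
      using U(2) by (auto simp: openin_open_subtopology)
    finally show ?thesis .
  qed
  show ?thesis
  proof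
    assume "openin T W"
    then show "W \<subseteq> topspace T \<and> (\<forall>U\<in>\<U>. openin Y (q ` (W \<inter> U)))"
      using chart charts openin_subset by (meson openin_Int)
  next
    assume *: "W \<subseteq> topspace T \<and> (\<forall>U\<in>\<U>. openin Y (q ` (W \<inter> U)))"
    have "W = (\<Union>U\<in>\<U>. W \<inter> U)" using * cover by blast
    moreover have "openin T (\<Union>U\<in>\<U>. W \<inter> U)" using * chart by blast
    ultimately show "openin T W" by simp
  qed
qed

lemma ex_topology_from_charts:
  assumes inj: "\<And>U. U \<in> \<U> \<Longrightarrow> inj_on q U"
    and overlap: "\<And>U V. U \<in> \<U> \<Longrightarrow> V \<in> \<U> \<Longrightarrow> openin Y (q ` (U \<inter> V))"
  obtains T where "topspace T = \<Union>\<U>"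
    and "\<And>U. U \<in> \<U> \<Longrightarrow> openin T U"
    and "\<And>U. U \<in> \<U> \<Longrightarrow> homeomorphic_map (subtopology T U) (subtopology Y (q ` U)) q"
proof -
  define opn where "opn W \<longleftrightarrow> W \<subseteq> \<Union>\<U> \<and> (\<forall>U\<in>\<U>. openin Y (q ` (W \<inter> U)))" for W
  have top: "istopology opn"
    unfolding istopology_def
  proof (intro conjI allI impI)
    fix S R assume "opn S" "opn R"
    \<comment> \<open>Images commute with intersections because \<open>q\<close> is injective on
      \<open>U\<close>.\<close>
    moreover have "q ` (S \<inter> R \<inter> U) = q ` (S \<inter> U) \<inter> q ` (R \<inter> U)" if "U \<in> \<U>" for U
      using inj[OF that] by (auto simp: inj_on_def)
    ultimately show "opn (S \<inter> R)" by (auto simp: opn_def)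
  next
    fix \<K> assume "\<forall>K\<in>\<K>. opn K"
    moreover have "q ` (\<Union>\<K> \<inter> U) = (\<Union>K\<in>\<K>. q ` (K \<inter> U))" for U by blast
    ultimately show "opn (\<Union>\<K>)" by (auto simp: opn_def)
  qed
  define T where "T = topology opn"
  have T: "openin T W \<longleftrightarrow> opn W" for W
    unfolding T_def using top by (simp add: topology_inverse')
  have U_open: "openin T U" if "U \<in> \<U>" for U
    using that overlap by (auto simp: T opn_def)
  have space: "topspace T = \<Union>\<U>"
  proof
    show "topspace T \<subseteq> \<Union>\<U>" using T openin_topspace[of T] unfolding opn_def by blast
    show "\<Union>\<U> \<subseteq> topspace T" using U_open openin_subset by blast
  qed
  have Y_open: "openin Y (q ` U)" if "U \<in> \<U>" for U
    using overlap[OF that that] by simp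
  have "homeomorphic_map (subtopology T U) (subtopology Y (q ` U)) q" if U: "U \<in> \<U>" for U
  proof (rule bijective_open_imp_homeomorphic_map)
    have tsp: "topspace (subtopology T U) = U" "topspace (subtopology Y (q ` U)) = q ` U"
      using openin_subset[OF U_open[OF U]] openin_subset[OF Y_open[OF U]] by auto
    show "q ` topspace (subtopology T U) = topspace (subtopology Y (q ` U))"
      unfolding tsp ..
    show "inj_on q (topspace (subtopology T U))" unfolding tsp by (rule inj[OF U])
    show "open_map (subtopology T U) (subtopology Y (q ` U)) q"
      unfolding open_map_def openin_open_subtopology[OF U_open[OF U]]
        openin_open_subtopology[OF Y_open[OF U]]
    proof (intro allI impI conjI)
      fix W assume "openin T W \<and> W \<subseteq> U"
      then have "openin Y (q ` (W \<inter> U))" "W \<inter> U = W"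
        using U by (auto simp: T opn_def)
      then show "openin Y (q ` W)" by simp
    qed auto
    show "continuous_map (subtopology T U) (subtopology Y (q ` U)) q"
      unfolding continuous_map_def tsp openin_open_subtopology[OF U_open[OF U]]
        openin_open_subtopology[OF Y_open[OF U]]
    proof (intro conjI allI impI)
      fix N assume N: "openin Y N \<and> N \<subseteq> q ` U"
      \<comment> \<open>On another chart \<open>V\<close> the preimage of \<open>N\<close> has as
        image the overlap image cut down to \<open>N\<close>, an intersection of two open
        sets.\<close>
      have "q ` ({x \<in> U. q x \<in> N} \<inter> V) = q ` (U \<inter> V) \<inter> N" for V by blast
      then show "openin T {x \<in> U. q x \<in> N}"
        using N overlap[OF U] U by (auto simp: T opn_def)
    qed auto
  qed
  with space U_open that show thesis by blast
qed


section \<open>Geometry of the Hawaiian earring\<close>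

lemma circle_loop_0 [simp]: "circle_loop i 0 = (0, 0)"
  and circle_loop_1 [simp]: "circle_loop i 1 = (0, 0)"
  by (simp_all add: circle_loop_def)

lemma continuous_on_circle_loop: "continuous_on S (circle_loop i)"
  unfolding circle_loop_def[abs_def] divide_inverse by (intro continuous_intros)

lemma circle_eq_image:
  assumes "1 \<le> i"
  shows "circle i = circle_loop i ` {0..1}"
proof (intro equalityI subsetI)
  have i: "real i \<noteq> 0" using assms by simp
  fix p assume "p \<in> circle i"
  then obtain x y where p: "p = (x, y)" "x\<^sup>2 + (y - 1 / real i)\<^sup>2 = 1 / (real i)\<^sup>2"
    by (auto simp: circle_def)
  \<comment> \<open>The point \<open>(1 - i y, i x)\<close> lies on the unit circle, with the base
    point at angle 0.\<close>
  have "(1 - real i * y)\<^sup>2 + (real i * x)\<^sup>2 = (real i)\<^sup>2 * (x\<^sup>2 + (y - 1 / real i)\<^sup>2)"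
    using i by (simp add: field_simps power2_eq_square)
  also have "\<dots> = 1" using i p(2) by simp
  finally obtain s where s: "0 \<le> s" "s < 2 * pi" "1 - real i * y = cos s" "real i * x = sin s"
    using sincos_total_2pi by metis
  then have "p = circle_loop i (s / (2 * pi))"
    using i by (simp add: p(1) circle_loop_def field_simps)
  moreover have "s / (2 * pi) \<in> {0..1}" using s by (simp add: field_simps)
  ultimately show "p \<in> circle_loop i ` {0..1}" by blast
next
  have i: "real i \<noteq> 0" using assms by simp
  fix p assume "p \<in> circle_loop i ` {0..1}"
  then obtain t where p: "p = circle_loop i t" by blast
  let ?s = "sin (2 * pi * t)" and ?c = "cos (2 * pi * t)"
  have "(?s / real i)\<^sup>2 + ((1 - ?c) / real i - 1 / real i)\<^sup>2 = (?s\<^sup>2 + ?c\<^sup>2) / (real i)\<^sup>2"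
    using i by (simp add: field_simps power2_eq_square)
  then show "p \<in> circle i" by (simp add: p circle_def circle_loop_def)
qed

lemma cos_2pi_less_1:
  assumes "0 < t" "t < 1"
  shows "cos (2 * pi * t) < 1"
proof (rule ccontr)
  assume "\<not> ?thesis"
  then have c: "cos (2 * pi * t) = 1" using cos_le_one[of "2 * pi * t"] by linarith
  then have "sin (2 * pi * t) = 0" using sin_cos_squared_add[of "2 * pi * t"] by simp
  with c obtain n :: int where "2 * pi * t = 0 + 2 * pi * n"
    using sin_cos_eq_iff[of "2 * pi * t" 0] by auto
  then have "t = of_int n" by simp
  with assms show False by simp
qed

text \<open>Solves the equation \<open>x\<^sup>2 + y\<^sup>2 = 2 y / i\<close> of the circle $C_i$ for \<open>i\<close>.\<close>

definition circle_index :: "real \<times> real \<Rightarrow> real" where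
  "circle_index p = 2 * snd p / ((fst p)\<^sup>2 + (snd p)\<^sup>2)"

lemma circle_loop_nonzero:
  assumes "1 \<le> i" "0 < t" "t < 1"
  shows "circle_loop i t \<noteq> (0, 0)"
  using assms cos_2pi_less_1[of t] by (simp add: circle_loop_def)

lemma circle_index_loop:
  assumes "1 \<le> i" "0 < t" "t < 1"
  shows "circle_index (circle_loop i t) = real i"
proof -
  let ?s = "sin (2 * pi * t)" and ?c = "cos (2 * pi * t)"
  have "(?s / real i)\<^sup>2 + ((1 - ?c) / real i)\<^sup>2 = ((?s\<^sup>2 + ?c\<^sup>2) + 1 - 2 * ?c) / (real i)\<^sup>2"
    by (simp add: power_divide add_divide_distrib[symmetric] power2_eq_square algebra_simps)
  also have "\<dots> = 2 * (1 - ?c) / (real i)\<^sup>2" by simp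
  finally show ?thesis
    using assms cos_2pi_less_1[of t]
    by (simp add: circle_index_def circle_loop_def) (simp add: power2_eq_square field_simps)
qed

text \<open>\<open>circle_index\<close> recovers the circle; sine and cosine then recover
  \<open>t\<close> modulo 1.\<close>

lemma circle_loop_inj:
  assumes "1 \<le> i" "0 < t" "t < 1" "1 \<le> j" "0 < s" "s < 1"
    and eq: "circle_loop i t = circle_loop j s"
  shows "i = j \<and> t = s"
proof
  show ij: "i = j"
    using circle_index_loop[of i t] circle_index_loop[of j s] assms by simp
  have "sin (2 * pi * t) = sin (2 * pi * s)" "cos (2 * pi * t) = cos (2 * pi * s)"
    using eq \<open>1 \<le> j\<close> by (simp_all add: ij circle_loop_def)
  then obtain n :: int where "2 * pi * t = 2 * pi * s + 2 * pi * n"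
    using sin_cos_eq_iff by blast
  then have "2 * pi * t = 2 * pi * (s + n)" by (simp add: distrib_left)
  then have t: "t = s + of_int n" by simp
  then have "\<bar>real_of_int n\<bar> < 1" using assms by linarith
  then show "t = s" using t by simp
qed

lemma hawaiian_cases:
  assumes "p \<in> hawaiian"
  obtains "p = (0, 0)" | i t where "1 \<le> i" "0 < t" "t < 1" "p = circle_loop i t"
proof -
  obtain i t where i: "1 \<le> i" "p = circle_loop i t" "0 \<le> t" "t \<le> 1"
    using assms by (auto simp: hawaiian_def circle_eq_image)
  then show thesis using that(1) that(2)[of i t] by (cases "t = 0 \<or> t = 1") auto
qed

lemma circle_loop_in_hawaiian: "1 \<le> i \<Longrightarrow> 0 \<le> t \<Longrightarrow> t \<le> 1 \<Longrightarrow> circle_loop i t \<in> hawaiian"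
  unfolding hawaiian_def by (intro UN_I[of i]) (auto simp: circle_eq_image)

text \<open>Off the base point \<open>circle_index\<close> is continuous, and on the earring it
  takes integer values there; the window of radius 1/2 around \<open>i\<close> therefore isolates
  one circle.\<close>

lemma openin_punctured_circle:
  assumes "1 \<le> i"
  shows "openin hawaiian_top (circle_loop i ` {0<..<1})"
proof -
  let ?O = "{p \<in> - {(0, 0)}. circle_index p \<in> {real i - 1 / 2 <..< real i + 1 / 2}}"
  have "continuous_on (- {(0, 0)}) circle_index"
    unfolding circle_index_def[abs_def]
    by (intro continuous_intros) (auto simp: prod_eq_iff sum_power2_eq_zero_iff)
  then have "open (- {(0, 0)} \<inter> circle_index -` {real i - 1 / 2 <..< real i + 1 / 2})"
    by (rule continuous_open_preimage) auto
  also have "- {(0, 0)} \<inter> circle_index -` {real i - 1 / 2 <..< real i + 1 / 2} = ?O" by auto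
  finally have "openin hawaiian_top (hawaiian \<inter> ?O)" by (rule openin_open_Int)
  also have "hawaiian \<inter> ?O = circle_loop i ` {0<..<1}"
  proof (intro equalityI subsetI)
    fix p assume p: "p \<in> hawaiian \<inter> ?O"
    then obtain j t where j: "1 \<le> j" "0 < t" "t < 1" "p = circle_loop j t"
      by (auto elim!: hawaiian_cases)
    then have "\<bar>real j - real i\<bar> < 1"
      using p circle_index_loop[of j t] by auto
    then have "j = i" by linarith
    with j show "p \<in> circle_loop i ` {0<..<1}" by auto
  next
    fix p assume "p \<in> circle_loop i ` {0<..<1}"
    then obtain t where "0 < t" "t < 1" "p = circle_loop i t" by auto
    then show "p \<in> hawaiian \<inter> ?O"
      using circle_loop_nonzero[OF assms, of t] circle_index_loop[OF assms, of t]
        circle_loop_in_hawaiian[OF assms, of t] by simp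
  qed
  finally show ?thesis .
qed

text \<open>The complement of \<open>S\<close> in \<open>{0..1}\<close> is compact, so its image is
  closed; by injectivity, removing that image from the punctured circle leaves the image of
  \<open>S\<close>.\<close>

lemma openin_circle_loop_image:
  assumes i: "1 \<le> i" and S: "open S" "S \<subseteq> {0<..<1}"
  shows "openin hawaiian_top (circle_loop i ` S)"
proof -
  have "compact ({0..1} - S)" using S(1) by (simp add: compact_diff)
  then have "closed (circle_loop i ` ({0..1} - S))"
    by (intro compact_imp_closed compact_continuous_image continuous_on_circle_loop)
  then have "openin hawaiian_top (circle_loop i ` {0<..<1} \<inter> - (circle_loop i ` ({0..1} - S)))"
    by (intro openin_Int_open openin_punctured_circle i) auto
  also have "circle_loop i ` {0<..<1} \<inter> - (circle_loop i ` ({0..1} - S)) = circle_loop i ` S"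
  proof (intro equalityI subsetI)
    fix p assume p: "p \<in> circle_loop i ` S"
    then obtain t where t: "t \<in> S" "p = circle_loop i t" by blast
    have "p \<noteq> circle_loop i s" if "s \<in> {0..1} - S" for s
    proof (cases "s = 0 \<or> s = 1")
      case True
      then show ?thesis using t S(2) circle_loop_nonzero[OF i, of t] by auto
    next
      case False
      then show ?thesis using t S(2) that circle_loop_inj[OF i _ _ i, of t s] by fastforce
    qed
    then show "p \<in> circle_loop i ` {0<..<1} \<inter> - (circle_loop i ` ({0..1} - S))"
      using t S(2) by blast
  qed auto
  finally show ?thesis .
qed

lemma zero_in_hawaiian_U: "(0, 0) \<in> hawaiian_U n"
  unfolding hawaiian_U_def
  by (rule UnI2, rule UN_I[of "n + 1"]) (auto simp: circle_def power_one_over)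

lemma circle_loop_in_hawaiian_U_iff:
  assumes "1 \<le> i" "0 < t" "t < 1"
  shows "circle_loop i t \<in> hawaiian_U n \<longleftrightarrow> n < i \<or> t < 3/8 \<or> 5/8 < t"
proof
  have unique: "j = i \<and> s = t" if "circle_loop i t = circle_loop j s" "1 \<le> j" "0 \<le> s" "s \<le> 1" for j s
    using that circle_loop_inj[OF assms, of j s] circle_loop_nonzero[OF assms]
    by (cases "s = 0 \<or> s = 1") auto
  assume "circle_loop i t \<in> hawaiian_U n"
  then consider j where "1 \<le> j" "circle_loop i t \<in> circle_loop j ` ({0..<3/8} \<union> {5/8<..1})"
    | j where "n < j" "circle_loop i t \<in> circle j"
    unfolding hawaiian_U_def circle_Vminus_def circle_Vplus_def by fastforce
  then show "n < i \<or> t < 3/8 \<or> 5/8 < t"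
  proof cases
    case 1
    then obtain s where "circle_loop i t = circle_loop j s" "s \<in> {0..<3/8} \<union> {5/8<..1}" by blast
    then show ?thesis using unique[of j s] 1(1) by auto
  next
    case 2
    then obtain s where "circle_loop i t = circle_loop j s" "0 \<le> s" "s \<le> 1"
      using circle_eq_image[of j] by auto
    then show ?thesis using unique[of j s] 2(1) by simp
  qed
next
  have *: "circle_loop i t \<in> circle i"
    unfolding circle_eq_image[OF assms(1)] using assms by simp
  assume "n < i \<or> t < 3/8 \<or> 5/8 < t"
  then consider "n < i" | "i \<le> n" "t < 3/8 \<or> 5/8 < t" by linarith
  then show "circle_loop i t \<in> hawaiian_U n"
  proof cases
    case 1
    then show ?thesis using * unfolding hawaiian_U_def by (intro UnI2 UN_I[of i]) auto
  next
    case 2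
    then have "circle_loop i t \<in> circle_Vminus i \<union> circle_Vplus i"
      using assms by (auto simp: circle_Vminus_def circle_Vplus_def)
    moreover have "i \<in> {1..n}" using 2 assms by simp
    ultimately show ?thesis unfolding hawaiian_U_def by blast
  qed
qed

lemma hawaiian_U_subset: "hawaiian_U n \<subseteq> hawaiian"
proof -
  have V: "circle_Vminus i \<union> circle_Vplus i \<subseteq> hawaiian" if "1 \<le> i" for i
    unfolding circle_Vminus_def circle_Vplus_def
    using circle_loop_in_hawaiian[OF that] by (auto simp del: One_nat_def)
  have C: "circle i \<subseteq> hawaiian" if "1 \<le> i" for i
    using that unfolding hawaiian_def by blast
  show ?thesis
    unfolding hawaiian_U_def
  proof (rule Un_least; rule UN_least)
    fix i assume "i \<in> {1..n}"
    then show "circle_Vminus i \<union> circle_Vplus i \<subseteq> hawaiian" by (intro V) simp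
  next
    fix i assume "i \<in> {n+1..}"
    then show "circle i \<subseteq> hawaiian" by (intro C) simp
  qed
qed

text \<open>The complement consists of the arcs over \<open>{3/8..5/8}\<close> on the first
  \<open>n\<close> circles, which are compact and finite in number.\<close>

lemma openin_hawaiian_U: "openin hawaiian_top (hawaiian_U n)"
proof -
  have "closed (circle_loop i ` {3/8..5/8})" for i
    by (intro compact_imp_closed compact_continuous_image continuous_on_circle_loop) simp
  then have "closed (\<Union>i\<in>{1..n}. circle_loop i ` {3/8..5/8})"
    by (intro closed_UN) auto
  then have "openin hawaiian_top (hawaiian \<inter> - (\<Union>i\<in>{1..n}. circle_loop i ` {3/8..5/8}))"
    by (intro openin_open_Int open_Compl)
  also have "hawaiian \<inter> - (\<Union>i\<in>{1..n}. circle_loop i ` {3/8..5/8}) = hawaiian_U n"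
  proof (intro set_eqI)
    fix p
    have "p \<notin> (\<Union>i\<in>{1..n}. circle_loop i ` {3/8..5/8}) \<longleftrightarrow> p \<in> hawaiian_U n"
      if "p \<in> hawaiian"
      using that
    proof (cases rule: hawaiian_cases)
      case 1
      have "p \<noteq> circle_loop j s" if "1 \<le> j" "s \<in> {3/8..5/8}" for j s
        using 1 circle_loop_nonzero[of j s] that by simp
      then have "p \<notin> (\<Union>i\<in>{1..n}. circle_loop i ` {3/8..5/8})" by force
      then show ?thesis using 1 zero_in_hawaiian_U by blast
    next
      case (2 i t)
      have inj: "i = j \<and> t = s" if "1 \<le> j" "s \<in> {3/8..5/8}" "p = circle_loop j s" for j s
        using circle_loop_inj[OF 2(1-3), of j s] 2(4) that by simp
      have "p \<in> (\<Union>i\<in>{1..n}. circle_loop i ` {3/8..5/8}) \<longleftrightarrow> i \<le> n \<and> t \<in> {3/8..5/8}"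
      proof
        assume "p \<in> (\<Union>i\<in>{1..n}. circle_loop i ` {3/8..5/8})"
        then obtain j s where "j \<in> {1..n}" "s \<in> {3/8..5/8}" "p = circle_loop j s" by blast
        with inj[of j s] show "i \<le> n \<and> t \<in> {3/8..5/8}" by simp
      next
        assume "i \<le> n \<and> t \<in> {3/8..5/8}"
        with 2 show "p \<in> (\<Union>i\<in>{1..n}. circle_loop i ` {3/8..5/8})"
          by (intro UN_I[of i] image_eqI[of _ _ t]) simp_all
      qed
      then show ?thesis
        using circle_loop_in_hawaiian_U_iff[OF 2(1-3), of n] 2(4) by auto
    qed
    then show "p \<in> hawaiian \<inter> - (\<Union>i\<in>{1..n}. circle_loop i ` {3/8..5/8}) \<longleftrightarrow> p \<in> hawaiian_U n"
      using hawaiian_U_subset by blast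
  qed
  finally show ?thesis .
qed


section \<open>Charts of the realization\<close>

lemma interior_in_param_image [simp]:
  "Interior e t \<in> hhat_param ws e' ` S \<longleftrightarrow> e = e' \<and> t \<in> S \<and> t \<noteq> 0 \<and> t \<noteq> 1"
  by (auto simp: hhat_param_def image_iff)

lemma vertex_in_param_image [simp]:
  "Vertex w \<in> hhat_param ws e ` S \<longleftrightarrow>
    0 \<in> S \<and> w = tail (hhat_graph ws) e \<or> 1 \<in> S \<and> w = head (hhat_graph ws) e"
  by (auto simp: hhat_param_def image_iff)

lemma verts_hhat_graph [simp]: "verts (hhat_graph ws) = verts (Gam_star ws)"
  by (simp add: hhat_graph_def)

lemma arcs_hhat_graph [simp]:
  "Tree_Edge d \<in> arcs (hhat_graph ws) \<longleftrightarrow> d \<in> arcs (Gam_star ws)"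
  "Loop v i \<in> arcs (hhat_graph ws) \<longleftrightarrow> v \<in> verts (Gam_star ws) \<and> 1 \<le> i \<and> i \<notin> label_set ws v"
  by (auto simp: hhat_graph_def)

lemma ends_hhat_graph [simp]:
  "tail (hhat_graph ws) (Tree_Edge d) = tail (Gam_star ws) d"
  "tail (hhat_graph ws) (Loop v i) = v"
  "head (hhat_graph ws) (Tree_Edge d) = head (Gam_star ws) d"
  "head (hhat_graph ws) (Loop v i) = v"
  by (simp_all add: hhat_graph_def)

text \<open>At each vertex of the final tree every positive label occurs exactly once outgoing and
  once incoming. One test by \<open>label_set\<close> serves both \<open>out_edge\<close> and
  \<open>in_edge\<close>, because the tree edges of either kind carry the same labels.\<close>

definition out_edge :: "(nat \<Rightarrow> word) \<Rightarrow> word \<Rightarrow> nat \<Rightarrow> hhat_arc" where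
  "out_edge ws v i = (if i \<in> label_set ws v then Tree_Edge (v, i) else Loop v i)"

definition in_edge :: "(nat \<Rightarrow> word) \<Rightarrow> word \<Rightarrow> nat \<Rightarrow> hhat_arc" where
  "in_edge ws v i =
    (if i \<in> label_set ws v then Tree_Edge (red (v @ [(i, False)]), i) else Loop v i)"

lemma hhat_label_edge [simp]:
  "hhat_label (out_edge ws v i) = i" "hhat_label (in_edge ws v i) = i"
  by (simp_all add: out_edge_def in_edge_def arc_label_def)

lemma arc_U_eq: "arc_U ws e = Interior e ` {1/4<..<3/4}"
  unfolding arc_U_def by (rule image_cong) (auto simp: hhat_param_def)

lemma q_Interior_image: "hhat_q ` Interior e ` S = circle_loop (hhat_label e) ` S"
  by (simp add: image_image)

section \<open>The edges at a vertex and its chart\<close>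

context word_sequence
begin

lemma hhat_arc_props:
  assumes "e \<in> arcs (hhat_graph ws)"
  shows "1 \<le> hhat_label e" "tail (hhat_graph ws) e \<in> verts (Gam_star ws)"
    "head (hhat_graph ws) e \<in> verts (Gam_star ws)"
  using assms
  by (cases e; auto simp: arcs_Gam_star inducedD(1,2)[OF induced_Gam_star] arc_label_def)+

lemma out_edge_iff:
  assumes "v \<in> verts (Gam_star ws)"
  shows "e \<in> arcs (hhat_graph ws) \<and> tail (hhat_graph ws) e = v \<longleftrightarrow>
    1 \<le> hhat_label e \<and> e = out_edge ws v (hhat_label e)"
proof (cases e)
  case (Tree_Edge d)
  obtain u i where d: "d = (u, i)" by fastforce
  show ?thesis
    using assms label_set_iff(1)[OF assms, of i] arcs_Gam_star[of v i]
    by (auto simp: Tree_Edge d out_edge_def arc_label_def inducedD(1)[OF induced_Gam_star])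
qed (use assms in \<open>auto simp: out_edge_def\<close>)

lemma in_edge_iff:
  assumes "v \<in> verts (Gam_star ws)"
  shows "e \<in> arcs (hhat_graph ws) \<and> head (hhat_graph ws) e = v \<longleftrightarrow>
    1 \<le> hhat_label e \<and> e = in_edge ws v (hhat_label e)"
proof (cases e)
  case (Tree_Edge d)
  obtain u i where d: "d = (u, i)" by fastforce
  have "red (red (v @ [(i, False)]) @ [(i, True)]) = v"
    using red_snoc_snoc_inv[of v i False] inducedD(4)[OF induced_Gam_star assms]
    by (simp add: red_reduced)
  moreover have "u = red (v @ [(i, False)])"
    if "u \<in> verts (Gam_star ws)" "red (u @ [(i, True)]) = v"
    using adjacent_sym[OF induced_Gam_star that(1) that(2)[symmetric]] by simp
  ultimately have "(u, i) \<in> arcs (Gam_star ws) \<and> red (u @ [(i, True)]) = v \<longleftrightarrow>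
      (u, i) \<in> arcs (Gam_star ws) \<and> u = red (v @ [(i, False)])"
    using arcs_Gam_star[of u i] by blast
  then show ?thesis
    using label_set_iff(2)[OF assms, of i] arcs_Gam_star[of u i]
    by (auto simp: Tree_Edge d in_edge_def arc_label_def inducedD(1,2)[OF induced_Gam_star])
qed (use assms in \<open>auto simp: in_edge_def\<close>)

lemma out_edge_in_arcs:
  assumes "v \<in> verts (Gam_star ws)" "1 \<le> i"
  shows "out_edge ws v i \<in> arcs (hhat_graph ws)" "tail (hhat_graph ws) (out_edge ws v i) = v"
  using out_edge_iff[OF assms(1), of "out_edge ws v i"] assms(2) by simp_all

lemma in_edge_in_arcs:
  assumes "v \<in> verts (Gam_star ws)" "1 \<le> i"
  shows "in_edge ws v i \<in> arcs (hhat_graph ws)" "head (hhat_graph ws) (in_edge ws v i) = v"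
  using in_edge_iff[OF assms(1), of "in_edge ws v i"] assms(2) by simp_all

lemma loop_beyond_rank:
  assumes "v \<in> verts (Gam_star ws)" "vertex_rank ws v < i"
  shows "Loop v i \<in> arcs (hhat_graph ws)" "out_edge ws v i = Loop v i"
  using label_set_vertex_rank[OF assms(1)] assms
  by (auto simp: out_edge_def)

lemma Vertex_in_vertex_U:
  assumes "v \<in> verts (Gam_star ws)"
  shows "Vertex w \<in> vertex_U ws v \<longleftrightarrow> w = v"
proof
  assume "Vertex w \<in> vertex_U ws v"
  then show "w = v"
    by (auto simp: vertex_U_def arc_Vminus_def arc_Vplus_def out_arcs_def in_arcs_def)
next
  assume "w = v"
  then have "Vertex w \<in> arc_Vminus ws (out_edge ws v 1)"
    using out_edge_in_arcs[OF assms, of 1] by (simp add: arc_Vminus_def)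
  moreover have "out_edge ws v 1 \<in> out_arcs (hhat_graph ws) v"
    using out_edge_in_arcs[OF assms, of 1] by (simp add: out_arcs_def)
  ultimately show "Vertex w \<in> vertex_U ws v" by (auto simp: vertex_U_def)
qed

lemma Interior_in_vertex_U:
  "Interior e t \<in> vertex_U ws v \<longleftrightarrow> e \<in> arcs (hhat_graph ws) \<and> 0 < t \<and> t < 1 \<and>
    (tail (hhat_graph ws) e = v \<and> t < 3/8 \<or> head (hhat_graph ws) e = v \<and> 5/8 < t \<or>
     (\<exists>i>vertex_rank ws v. e = Loop v i))"
  by (auto simp: vertex_U_def arc_Vminus_def arc_Vplus_def out_arcs_def in_arcs_def)

text \<open>A normal form in which label and parameter determine the edge, so that a point can be
  recovered from its image under \<open>hhat_q\<close>. Beyond the rank \<open>out_edge\<close> and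
  \<open>in_edge\<close> are both the loop, which makes the form cover entire loops.\<close>

lemma vertex_U_cases:
  assumes "v \<in> verts (Gam_star ws)" "x \<in> vertex_U ws v"
  obtains (vertex) "x = Vertex v"
    | (interior) i t where "1 \<le> i" "0 < t" "t < 1" "i \<le> vertex_rank ws v \<longrightarrow> t < 3/8 \<or> 5/8 < t"
        "x = Interior (if t < 3/8 then out_edge ws v i else if 5/8 < t then in_edge ws v i else Loop v i) t"
proof (cases x)
  case (Vertex w)
  then show thesis using assms Vertex_in_vertex_U that(1) by simp
next
  case (Interior e t)
  note e = assms(2)[unfolded Interior Interior_in_vertex_U]
  have 1: "1 \<le> hhat_label e" using e hhat_arc_props(1) by blast
  have loop: "out_edge ws v i = Loop v i \<and> in_edge ws v i = Loop v i" if "vertex_rank ws v < i" for i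
    using loop_beyond_rank[OF assms(1) that] by (auto simp: in_edge_def)
  consider "tail (hhat_graph ws) e = v" "t < 3/8" | "head (hhat_graph ws) e = v" "5/8 < t"
    | i where "vertex_rank ws v < i" "e = Loop v i" using e by blast
  then show thesis
  proof cases
    case 1
    then show thesis
      using out_edge_iff[OF assms(1), of e] e Interior that(2)[of "hhat_label e" t] by simp
  next
    case 2
    then show thesis
      using in_edge_iff[OF assms(1), of e] e Interior that(2)[of "hhat_label e" t] by simp
  next
    case 3
    then show thesis
      using loop[OF 3(1)] e Interior \<open>1 \<le> hhat_label e\<close> that(2)[of i t] by simp
  qed
qed

lemma inj_on_vertex_U:
  assumes v: "v \<in> verts (Gam_star ws)"
  shows "inj_on hhat_q (vertex_U ws v)"
proof (rule inj_onI)
  fix x y assume x: "x \<in> vertex_U ws v" and y: "y \<in> vertex_U ws v" and eq: "hhat_q x = hhat_q y"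
  show "x = y"
    using v x
  proof (cases rule: vertex_U_cases)
    case x: vertex
    from v y show ?thesis
    proof (cases rule: vertex_U_cases)
      case vertex
      then show ?thesis using x by simp
    next
      case (interior j s)
      then have "hhat_q y = circle_loop j s" by simp
      then show ?thesis using x eq circle_loop_nonzero[OF interior(1-3)] by simp
    qed
  next
    case x: (interior i t)
    then have qx: "hhat_q x = circle_loop i t" by simp
    from v y show ?thesis
    proof (cases rule: vertex_U_cases)
      case vertex
      then show ?thesis using qx eq circle_loop_nonzero[OF x(1-3)] by simp
    next
      case y: (interior j s)
      then have "hhat_q y = circle_loop j s" by simp
      then have "i = j \<and> t = s"
        using circle_loop_inj[OF x(1-3) y(1-3)] qx eq by simp
      then show ?thesis using x(5) y(5) by simp
    qed
  qed
qed

lemma q_vertex_U: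
  assumes v: "v \<in> verts (Gam_star ws)"
  shows "hhat_q ` vertex_U ws v = hawaiian_U (vertex_rank ws v)"
proof (intro equalityI subsetI)
  fix p assume "p \<in> hhat_q ` vertex_U ws v"
  then obtain x where x: "x \<in> vertex_U ws v" "p = hhat_q x" by blast
  from v x(1) show "p \<in> hawaiian_U (vertex_rank ws v)"
  proof (cases rule: vertex_U_cases)
    case vertex
    then show ?thesis using x(2) zero_in_hawaiian_U by simp
  next
    case (interior i t)
    then have "p = circle_loop i t" using x(2) by simp
    then show ?thesis
      using interior circle_loop_in_hawaiian_U_iff[OF interior(1-3), of "vertex_rank ws v"]
      by auto
  qed
next
  fix p assume p: "p \<in> hawaiian_U (vertex_rank ws v)"
  then have "p \<in> hawaiian" using hawaiian_U_subset by blast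
  then show "p \<in> hhat_q ` vertex_U ws v"
  proof (cases rule: hawaiian_cases)
    case 1
    then show ?thesis using Vertex_in_vertex_U[OF v, of v] by (intro image_eqI[of _ _ "Vertex v"]) auto
  next
    case (2 i t)
    then consider "t < 3/8" | "5/8 < t" | "vertex_rank ws v < i"
      using p circle_loop_in_hawaiian_U_iff[OF 2(1-3), of "vertex_rank ws v"] by blast
    then have "\<exists>e. Interior e t \<in> vertex_U ws v \<and> hhat_label e = i"
    proof cases
      case 1
      then show ?thesis using out_edge_in_arcs[OF v 2(1)] 2
        by (intro exI[of _ "out_edge ws v i"]) (simp add: Interior_in_vertex_U)
    next
      case b: 2
      then show ?thesis using in_edge_in_arcs[OF v 2(1)] 2
        by (intro exI[of _ "in_edge ws v i"]) (simp add: Interior_in_vertex_U)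
    next
      case 3
      then show ?thesis using loop_beyond_rank(1)[OF v 3] 2
        by (intro exI[of _ "Loop v i"]) (simp add: Interior_in_vertex_U)
    qed
    then obtain e where e: "Interior e t \<in> vertex_U ws v" "hhat_label e = i" by blast
    then show ?thesis using 2(4) by (intro image_eqI[OF _ e(1)]) simp
  qed
qed

section \<open>Edge charts and the overlaps of charts\<close>

lemma inj_on_arc_U:
  assumes "e \<in> arcs (hhat_graph ws)"
  shows "inj_on hhat_q (arc_U ws e)"
  using circle_loop_inj[OF hhat_arc_props(1)[OF assms] _ _ hhat_arc_props(1)[OF assms]]
  by (fastforce simp: arc_U_eq inj_on_def)

lemma q_arc_U: "hhat_q ` arc_U ws e = circle_U (hhat_label e)"
  by (simp add: arc_U_eq q_Interior_image circle_U_def)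

lemma openin_q_arc_image:
  assumes "e \<in> arcs (hhat_graph ws)" "open S" "S \<subseteq> {0<..<1}"
  shows "openin hawaiian_top (hhat_q ` Interior e ` S)"
  unfolding q_Interior_image
  using openin_circle_loop_image[OF hhat_arc_props(1)[OF assms(1)] assms(2,3)] .

lemma openin_q_arc_vertex:
  assumes "e \<in> arcs (hhat_graph ws)" "v \<in> verts (Gam_star ws)"
  shows "openin hawaiian_top (hhat_q ` (arc_U ws e \<inter> vertex_U ws v))"
proof -
  \<comment> \<open>The parameters of \<open>arc_U\<close>, from 1/4 to 3/4, are cut down to those
    below 3/8 at the tail and above 5/8 at the head; a loop beyond the rank keeps them all.\<close>
  define S :: "real set" where "S = (if tail (hhat_graph ws) e = v then {1/4<..<3/8} else {}) \<union>
    (if head (hhat_graph ws) e = v then {5/8<..<3/4} else {}) \<union>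
    (if \<exists>i>vertex_rank ws v. e = Loop v i then {1/4<..<3/4} else {})"
  have "arc_U ws e \<inter> vertex_U ws v = Interior e ` S"
    using assms(1) unfolding arc_U_eq S_def by (auto simp: Interior_in_vertex_U)
  moreover have "open S" unfolding S_def by (intro open_Un) simp_all
  moreover have "S \<subseteq> {0<..<1}" by (auto simp: S_def)
  ultimately show ?thesis using openin_q_arc_image[OF assms(1)] by simp
qed

text \<open>Parameters below 3/8 fix the tail of the edge and those above 5/8 its head; in between
  only loops occur, and a loop has a single vertex.\<close>

lemma vertex_U_disjoint:
  assumes "v \<in> verts (Gam_star ws)" "w \<in> verts (Gam_star ws)" "v \<noteq> w"
  shows "vertex_U ws v \<inter> vertex_U ws w = {}"
proof -
  have "x \<notin> vertex_U ws w" if "x \<in> vertex_U ws v" for x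
  proof (cases x)
    case (Vertex u)
    then show ?thesis using that assms Vertex_in_vertex_U by auto
  next
    case (Interior e t)
    then show ?thesis using that assms by (auto simp: Interior_in_vertex_U)
  qed
  then show ?thesis by blast
qed

definition charts :: "hhat_point set set" where
  "charts = arc_U ws ` arcs (hhat_graph ws) \<union> vertex_U ws ` verts (Gam_star ws)"

lemma charts_cases:
  assumes "U \<in> charts"
  obtains e where "e \<in> arcs (hhat_graph ws)" "U = arc_U ws e"
    | v where "v \<in> verts (Gam_star ws)" "U = vertex_U ws v"
  using assms by (auto simp: charts_def)

lemma inj_on_charts: "U \<in> charts \<Longrightarrow> inj_on hhat_q U"
  by (auto elim!: charts_cases intro: inj_on_arc_U inj_on_vertex_U)

lemma openin_q_overlap:
  assumes "U \<in> charts" "V \<in> charts"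
  shows "openin hawaiian_top (hhat_q ` (U \<inter> V))"
  using assms(1)
proof (cases rule: charts_cases)
  case U: (1 e)
  from assms(2) show ?thesis
  proof (cases rule: charts_cases)
    case (1 d)
    show ?thesis
    proof (cases "d = e")
      case True
      have "{1/4<..<3/4} \<subseteq> {0<..<1::real}" by auto
      then show ?thesis
        using True U 1 openin_q_arc_image[OF U(1), of "{1/4<..<3/4}"] by (simp add: arc_U_eq)
    next
      case False
      then have "U \<inter> V = {}" using U 1 by (auto simp: arc_U_eq)
      then show ?thesis by simp
    qed
  next
    case (2 v)
    then show ?thesis using U openin_q_arc_vertex by simp
  qed
next
  case U: (2 v)
  from assms(2) show ?thesis
  proof (cases rule: charts_cases)
    case (1 e)
    then show ?thesis using U openin_q_arc_vertex by (simp add: Int_commute)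
  next
    case (2 w)
    show ?thesis
    proof (cases "v = w")
      case True
      then show ?thesis using U 2 q_vertex_U openin_hawaiian_U by simp
    next
      case False
      then show ?thesis using U 2 vertex_U_disjoint by simp
    qed
  qed
qed

lemma openin_q_charts: "U \<in> charts \<Longrightarrow> openin hawaiian_top (hhat_q ` U)"
  using openin_q_overlap[of U U] by simp

lemma Union_charts: "\<Union>charts = hhat ws"
proof (intro equalityI subsetI)
  fix x assume "x \<in> \<Union>charts"
  then obtain U where U: "U \<in> charts" "x \<in> U" by blast
  show "x \<in> hhat ws"
    using U
    by (cases x; elim charts_cases)
      (auto simp: arc_U_eq hhat_def Vertex_in_vertex_U Interior_in_vertex_U)
next
  fix x assume x: "x \<in> hhat ws"
  show "x \<in> \<Union>charts"
  proof (cases x)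
    case (Vertex v)
    then show ?thesis using x by (auto simp: hhat_def charts_def Vertex_in_vertex_U)
  next
    case (Interior e t)
    then have e: "e \<in> arcs (hhat_graph ws)" "0 < t" "t < 1" using x by (auto simp: hhat_def)
    \<comment> \<open>The parameter ranges below 3/8, between 1/4 and 3/4, and above 5/8 cover the
      edge.\<close>
    then consider "x \<in> arc_U ws e" | "x \<in> vertex_U ws (tail (hhat_graph ws) e)"
      | "x \<in> vertex_U ws (head (hhat_graph ws) e)"
      using Interior by (fastforce simp: arc_U_eq Interior_in_vertex_U image_iff)
    then show ?thesis
      using e(1) hhat_arc_props(2,3)[OF e(1)] unfolding charts_def by cases blast+
  qed
qed

lemma is_hhat_top_iff:
  "is_hhat_top ws T \<longleftrightarrow> topspace T = hhat ws \<and> (\<forall>U\<in>charts. openin T U \<and>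
     homeomorphic_map (subtopology T U) (subtopology hawaiian_top (hhat_q ` U)) hhat_q)"
  unfolding is_hhat_top_def charts_def ball_Un ball_simps
  by (simp add: q_arc_U q_vertex_U cong: ball_cong)

text \<open>\<open>hhat_top\<close> is a definite description, so its properties become available
  only through existence and uniqueness. For uniqueness, \<open>open_charts_determine\<close> gives
  every candidate the same open sets.\<close>

lemma is_hhat_top_hhat_top: "is_hhat_top ws (hhat_top ws)"
proof -
  obtain T where "topspace T = \<Union>charts" "\<And>U. U \<in> charts \<Longrightarrow> openin T U"
    "\<And>U. U \<in> charts \<Longrightarrow>
      homeomorphic_map (subtopology T U) (subtopology hawaiian_top (hhat_q ` U)) hhat_q"
    using ex_topology_from_charts[of charts hhat_q hawaiian_top] inj_on_charts openin_q_overlap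
    by blast
  then have T: "is_hhat_top ws T"
    unfolding is_hhat_top_iff Union_charts by blast
  have "T' = T" if T': "is_hhat_top ws T'" for T'
    unfolding topology_eq
  proof
    have "openin R W \<longleftrightarrow> W \<subseteq> hhat ws \<and> (\<forall>U\<in>charts. openin hawaiian_top (hhat_q ` (W \<inter> U)))"
      if "is_hhat_top ws R" for R W
      using open_charts_determine[of charts R hawaiian_top hhat_q W] that openin_q_charts
      unfolding is_hhat_top_iff Union_charts by simp
    from this[OF T] this[OF T'] show "openin T' W \<longleftrightarrow> openin T W" for W by simp
  qed
  with T show ?thesis unfolding hhat_top_def by (rule theI)
qed

lemma local_homeomorphism_hhat_q: "local_homeomorphism (hhat_top ws) hawaiian_top hhat_q"
  unfolding local_homeomorphism_def
proof
  note top = is_hhat_top_hhat_top[unfolded is_hhat_top_iff]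
  fix x assume "x \<in> topspace (hhat_top ws)"
  then have "x \<in> \<Union>charts" using top Union_charts by simp
  then obtain U where U: "U \<in> charts" "x \<in> U" by blast
  with top openin_q_charts[OF U(1)]
  show "\<exists>U. openin (hhat_top ws) U \<and> x \<in> U \<and> openin hawaiian_top (hhat_q ` U) \<and>
      homeomorphic_map (subtopology (hhat_top ws) U) (subtopology hawaiian_top (hhat_q ` U)) hhat_q"
    by blast
qed

end

theorem proposition3p1:
  fixes ws :: "nat \<Rightarrow> word"
  assumes "ws ` {1..} = {x \<in> all_words. x \<noteq> []}"
  shows "local_homeomorphism (hhat_top ws) hawaiian_top hhat_q"
proof -
  interpret word_sequence ws
  proof
    show "ws j \<in> all_words" if "1 \<le> j" for j
      using assms that by (metis (mono_tags, lifting) CollectD atLeast_iff image_eqI)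
  qed
  show ?thesis by (rule local_homeomorphism_hhat_q)
qed

end
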